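(* Let $\mathbb{F}$ be a finite field of characteristic $p$. Let $P(y) \in (\mathbb{F}[t])[y]$ be a nonconstant polynomial of degree $d$ and derivational degree $k$. Write $P(y) = a_0 + \sum_{i=1}^n \eta_i(y^{r_i})$, where $a_0\in\mathbb{F}[t]$, $\eta_1,\dots,\eta_n \in (\mathbb{F}[t])[y]$ are nonzero additive polynomials and $r_1,\dots,r_n$ are distinct positive integers not divisible by $p$. Let $H_i = \eta_i(\mathbb{F}[t])$ and $H = \sum_{i=1}^n H_i \le (\mathbb{F}[t],+)$. Then for any monic $Q(t) \in \mathbb{F}[t]$ and any $f : \mathbb{F}[t]_Q \to \mathbb{C}$, \[ \left\| \mathbb{E}_{y \in \mathbb{F}[t]_Q} f(x+P(y)) - \mathbb{E}_{z \in H_Q} f(x + a_0 + z) \right\|_{L^2(\mathbb{F}[t]_Q)} \le \left( p^{2\lfloor \log_p d\rfloor} \frac{k-1}{\mathrm{lpf}(Q)} \right)^{1/2^{k-1}} \|f\|_{L^2(\mathbb{F}[t]_Q)}, \] where the left-hand $L^2$ norm is in the variable $x\in\mathbb{F}[t]_Q$ and $H_Q = \{ z \bmod Q : z \in H\}$.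
   Context: $\mathbb{F}[t]_Q = \mathbb{F}[t]/Q\mathbb{F}[t]$; polynomials with coefficients in $\mathbb{F}[t]$ are evaluated on $\mathbb{F}[t]_Q$ after reducing coefficients mod $Q$. $|Q| = |\mathbb{F}|^{\deg Q}$; if $Q = Q_1^{s_1}\cdots Q_r^{s_r}$ is the factorization into distinct monic irreducibles, $\mathrm{lpf}(Q)=\min_i |Q_i|$. A polynomial $\eta(y)$ is additive if $\eta(x+y)=\eta(x)+\eta(y)$ identically (equivalently $\eta(y)=\sum_j c_j y^{p^j}$). Let $\mathbb{F}((t^{-1}))$ be the field of formal Laurent series $\sum_{j\le N} c_j t^j$, $c_j\in\mathbb{F}$. For $u \in \mathbb{F}((t^{-1}))$ and a function $g$ define $\partial_u g(x) = g(x+u)-g(x)$ and $\partial_{u_1,\dots,u_j} = \partial_{u_j}\partial_{u_1,\dots,u_{j-1}}$. The derivational degree of a polynomial $P$ is the least $d'\ge 0$ such that $\partial_{u_1,\dots,u_{d'+1}}P(y)=0$ for all $u_1,\dots,u_{d'+1},y\in\mathbb{F}((t^{-1}))$. $\mathbb{E}_{x\in S}$ denotes the average over a finite set $S$ and $\|f\|_{L^2(S)} = (\mathbb{E}_{x\in S}|f(x)|^2)^{1/2}$. *)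

theory Defs
  imports
    Complex_Main
    "HOL-Library.Cardinality"
    "HOL-Library.Set_Algebras"
    "HOL-Computational_Algebra.Computational_Algebra"
begin

text \<open>
  A polynomial ring \<open>F[t]\<close> is \<open>'a poly\<close> and \<open>F[t][y]\<close> is \<open>'a poly poly\<close>.  The field
  \<open>F((1/t))\<close> is \<open>'a fls\<close> with the Laurent variable \<open>fls_X\<close> playing the role of \<open>1/t\<close>, so
  that \<open>t\<close> itself is \<open>fls_X_inv\<close>.
\<close>

definition laurent_of_poly :: "'a::field poly \<Rightarrow> 'a fls" where
  "laurent_of_poly a = poly (map_poly fls_const a) fls_X_inv"

definition difference :: "'b::ab_group_add \<Rightarrow> ('b \<Rightarrow> 'b) \<Rightarrow> 'b \<Rightarrow> 'b" where
  "difference u g = (\<lambda>x. g (x + u) - g x)"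

text \<open>
  For \<open>us = [u\<^sub>1, \<dots>, u\<^sub>j]\<close>, the term \<open>fold difference us g\<close> applies the difference in
  direction \<open>u\<^sub>1\<close> first and the one in direction \<open>u\<^sub>j\<close> last.
\<close>

definition derivational_degree :: "'a::field poly poly \<Rightarrow> nat" where
  "derivational_degree P =
    (LEAST d'. \<forall>us. length us = d' + 1 \<longrightarrow>
       (\<forall>y. fold difference us (poly (map_poly laurent_of_poly P)) y = 0))"

text \<open>
  The identity \<open>\<eta>(x + y) = \<eta>(x) + \<eta>(y)\<close> is stated formally, in the ring \<open>R[x][y]\<close>: there
  the coefficients of \<open>\<eta>\<close> are lifted to constants of \<open>R[x]\<close>, \<open>\<eta>(x)\<close> is the constant
  \<open>[:\<eta>:]\<close>, and \<open>x + y\<close> is \<open>[:[:0, 1:], 1:]\<close>.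
\<close>

definition additive_poly :: "'b::comm_ring_1 poly \<Rightarrow> bool" where
  "additive_poly \<eta> \<longleftrightarrow>
    pcompose (map_poly (\<lambda>c. [:c:]) \<eta>) [:[:0, 1:], 1:] = [:\<eta>:] + map_poly (\<lambda>c. [:c:]) \<eta>"

definition poly_abs :: "'a::{field,finite} poly \<Rightarrow> nat" where
  "poly_abs Q = CARD('a) ^ degree Q"

text \<open>
  For the monic \<open>Q = 1\<close> there is no irreducible factor, and the minimum over the empty set
  is \<open>\<infinity>\<close>, with \<open>c / \<infinity> = 0\<close>.  As only the quotient by \<open>lpf Q\<close> is ever used, this is
  encoded by \<open>lpf 1 = 0\<close>, since \<open>c / 0 = 0\<close> in HOL.
\<close>

definition lpf :: "'a::{field,finite} poly \<Rightarrow> nat" where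
  "lpf Q = (if degree Q = 0 then 0
            else Min (poly_abs ` {\<pi>. irreducible \<pi> \<and> lead_coeff \<pi> = 1 \<and> \<pi> dvd Q}))"

text \<open>
  The quotient ring \<open>F[t]/Q\<close> is represented by the set of reduced residues, with ring
  operations followed by reduction modulo \<open>Q\<close>.
\<close>

definition residues_mod :: "'a::field poly \<Rightarrow> 'a poly set" where
  "residues_mod Q = range (\<lambda>x. x mod Q)"

definition average :: "'b set \<Rightarrow> ('b \<Rightarrow> 'c::real_normed_field) \<Rightarrow> 'c" where
  "average S g = (\<Sum>x\<in>S. g x) / of_nat (card S)"

definition L2_norm :: "'b set \<Rightarrow> ('b \<Rightarrow> complex) \<Rightarrow> real" where
  "L2_norm S f = sqrt (average S (\<lambda>x. (cmod (f x))\<^sup>2))"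

end

(*
  The average on the left is diagonalised by the additive characters chi of F[t]/Q. If chi is trivial
  on H, then chi (P y) = chi a0 and its multiplier vanishes; otherwise the multiplier is the
  exponential sum E_y chi (P y). Writing r_i in base p, the power y^(r_i) is a product of as many
  additive maps y^(p^l) as the digit sum of r_i, which is therefore the derivational degree of the
  i-th summand. Van der Corput differencing down to degree one leaves the proportion
  of directions (u_1, ..., u_(k-1)) for which a multiadditive form is degenerate. After restriction
  to the multiples of a suitable divisor of Q, this condition takes place over a residue field
  F[t]/pi, where it is the vanishing of a nonzero polynomial of degree at most p^(2L),
  L = floor (log_p d), in each u_j; the Schwartz-Zippel lemma bounds that proportion.
*)

theory Submission
  imports Defs "HOL-Combinatorics.Multiset_Permutations" "HOL-Analysis.Convex"
begin

section \<open>Iterated differences and polarization\<close>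

text \<open>Two obstacles shape the argument. The summand of largest digit sum may be invisible to
  \<chi>, because \<chi> can be trivial on its H_i; differencing is therefore adapted to \<chi> and
  stops at the largest digit sum s among the summands that \<chi> sees, and s \<le> k suffices
  because the averages have modulus at most 1. Moreover, degeneracy is a condition on a character
  (for all y), with y entering through different Frobenius powers y^(p^l). Over a residue field
  these powers are moved from y to the coefficients by taking p^l-th roots, and raising the result
  to the power p^L clears the roots; each remaining exponent is p^(L-l) times some p^s with l, s
  \<le> L, whence p^(2L). In this count, p not dividing r_i does two jobs: it supplies a digit at
  p^0, whose coefficient can be kept a unit modulo \<pi>, and it makes the total degrees of
  monomials for different i distinct, so that nothing cancels. Base-p digits are below p, so the
  factorials produced by polarization are invertible.\<close>

definition vanishing_differences :: "nat \<Rightarrow> ('b::ab_group_add \<Rightarrow> 'b) \<Rightarrow> bool" where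
  "vanishing_differences s g \<longleftrightarrow> (\<forall>us y. length us = s \<longrightarrow> fold difference us g y = 0)"

lemma vanishing_differences_0: "vanishing_differences 0 g \<longleftrightarrow> (\<forall>y. g y = 0)"
  by (simp add: vanishing_differences_def)

lemma vanishing_differences_Suc:
  "vanishing_differences (Suc s) g \<longleftrightarrow> (\<forall>u. vanishing_differences s (difference u g))"
proof -
  have "(\<forall>us. length us = Suc s \<longrightarrow> P us) \<longleftrightarrow> (\<forall>u us. length us = s \<longrightarrow> P (u # us))"
    for P :: "'a list \<Rightarrow> bool"
    by (metis length_Cons length_Suc_conv)
  from this[of "\<lambda>us. \<forall>y. fold difference us g y = 0"] show ?thesis
    by (auto simp: vanishing_differences_def)
qed

lemma fold_difference_add:
  "fold difference us (\<lambda>y. g y + h y) = (\<lambda>y. fold difference us g y + fold difference us h y)"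
proof (induction us arbitrary: g h)
  case (Cons u us)
  have "difference u (\<lambda>y. g y + h y) = (\<lambda>y. difference u g y + difference u h y)"
    by (auto simp: difference_def)
  then show ?case by (simp add: Cons)
qed simp

lemma fold_difference_sum:
  "fold difference us (\<lambda>y. \<Sum>i\<in>A. g i y) = (\<lambda>y. \<Sum>i\<in>A. fold difference us (g i) y)"
proof (induction us arbitrary: g)
  case (Cons u us)
  have "difference u (\<lambda>y. \<Sum>i\<in>A. g i y) = (\<lambda>y. \<Sum>i\<in>A. difference u (g i) y)"
    by (auto simp: difference_def sum_subtractf)
  then show ?case by (simp add: Cons)
qed simp

lemma fold_difference_additive:
  assumes "\<And>x y. \<phi> (x + y) = \<phi> x + \<phi> y"
  shows "fold difference us (\<lambda>y. \<phi> (g y)) = (\<lambda>y. \<phi> (fold difference us g y))"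
proof (induction us arbitrary: g)
  case (Cons u us)
  have "\<phi> (x - y) = \<phi> x - \<phi> y" for x y
    using assms[of "x - y" y] by (simp add: algebra_simps)
  then have "difference u (\<lambda>y. \<phi> (g y)) = (\<lambda>y. \<phi> (difference u g y))"
    by (auto simp: difference_def)
  then show ?case by (simp add: Cons)
qed simp

lemma fold_difference_const:
  "us \<noteq> [] \<Longrightarrow> fold difference us (\<lambda>y. c) = (\<lambda>y. 0)"
proof (induction us arbitrary: c)
  case (Cons u us)
  have "difference u (\<lambda>y. c) = (\<lambda>y. 0)" for c :: 'a by (auto simp: difference_def)
  then show ?case using Cons by (cases us) simp_all
qed simp

text \<open>Differences commute. Moving one direction to the end rewrites a difference with first
  direction \<open>y\<close> at base point 0 as the increment from 0 to \<open>y\<close> of the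
  remaining differences.\<close>

lemma fold_difference_rotate:
  "fold difference (u # us) g = fold difference (us @ [u]) g"
proof (induction us arbitrary: g)
  case (Cons v us)
  have "difference v (difference u g) = difference u (difference v g)"
    by (auto simp: difference_def algebra_simps)
  then show ?case using Cons[of "difference v g"] by simp
qed simp

lemma vanishing_differences_mono:
  "vanishing_differences s g \<Longrightarrow> s \<le> s' \<Longrightarrow> vanishing_differences s' g"
proof -
  have "fold difference us g y = 0" if "vanishing_differences s g" "length us \<ge> s" for us y
  proof (cases "length us = s")
    case False
    define vs ws where "vs = take s us" and "ws = drop s us"
    have "length vs = s" "ws \<noteq> []" "us = vs @ ws"
      using that False by (auto simp: vs_def ws_def)
    moreover have "fold difference vs g = (\<lambda>y. 0)"
      using that \<open>length vs = s\<close> by (auto simp: vanishing_differences_def)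
    ultimately show ?thesis by (simp add: fold_difference_const)
  qed (use that in \<open>auto simp: vanishing_differences_def\<close>)
  then show "vanishing_differences s g \<Longrightarrow> s \<le> s' \<Longrightarrow> vanishing_differences s' g"
    unfolding vanishing_differences_def[of s'] by auto
qed

lemma vanishing_differences_add:
  "vanishing_differences s g \<Longrightarrow> vanishing_differences s h
    \<Longrightarrow> vanishing_differences s (\<lambda>y. g y + h y)"
  by (simp add: vanishing_differences_def fold_difference_add)

lemma vanishing_differences_sum:
  "(\<And>i. i \<in> A \<Longrightarrow> vanishing_differences s (g i))
    \<Longrightarrow> vanishing_differences s (\<lambda>y. \<Sum>i\<in>A. g i y)"
  by (simp add: vanishing_differences_def fold_difference_sum)

lemma vanishing_differences_mult_const:
  fixes c :: "'b::comm_ring_1"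
  shows "vanishing_differences s g \<Longrightarrow> vanishing_differences s (\<lambda>y. c * g y)"
  by (simp add: vanishing_differences_def fold_difference_additive[of "(*) c"] distrib_left)

text \<open>Product rule: the difference of \<open>h y * g y\<close> in direction u is
  \<open>h y\<close> times the difference of g, plus terms in which h occurs only as the constant
  \<open>h u\<close>. Only the first needs the induction, so an additive factor raises the degree by
  at most one.\<close>

lemma vanishing_differences_mult_additive:
  fixes h :: "'b::comm_ring_1 \<Rightarrow> 'b"
  assumes h: "\<And>x y. h (x + y) = h x + h y"
  shows "vanishing_differences s g \<Longrightarrow> vanishing_differences (Suc s) (\<lambda>y. h y * g y)"
proof (induction s arbitrary: g)
  case 0
  then show ?case by (simp add: vanishing_differences_0 vanishing_differences_Suc difference_def)
next
  case (Suc s)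
  have "vanishing_differences (Suc s) (difference u (\<lambda>y. h y * g y))" for u
  proof -
    have D: "vanishing_differences s (difference u g)"
      using Suc.prems by (simp add: vanishing_differences_Suc)
    have "difference u (\<lambda>y. h y * g y)
        = (\<lambda>y. (h y * difference u g y + h u * difference u g y) + h u * g y)"
      by (auto simp: difference_def h algebra_simps)
    then show ?thesis
      using Suc.IH[OF D] vanishing_differences_mult_const[OF D, of "h u"]
        vanishing_differences_mult_const[OF Suc.prems, of "h u"]
        vanishing_differences_mono[of s _ "Suc s"]
      by (auto intro!: vanishing_differences_add)
  qed
  then show ?case by (simp add: vanishing_differences_Suc[of "Suc s"])
qed

lemma vanishing_differences_power:
  "vanishing_differences (Suc n) (\<lambda>y::'b::comm_ring_1. y ^ n)"
proof (induction n)
  case (Suc n)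
  then show ?case using vanishing_differences_mult_additive[of "\<lambda>y. y"] by simp
qed (simp add: vanishing_differences_Suc vanishing_differences_0 difference_def)

lemma vanishing_differences_poly:
  fixes P :: "'b::comm_ring_1 poly"
  shows "vanishing_differences (Suc (degree P)) (poly P)"
proof -
  have "poly P = (\<lambda>y. \<Sum>i\<le>degree P. coeff P i * y ^ i)"
    by (auto simp: poly_altdef)
  then show ?thesis
    by (auto intro!: vanishing_differences_sum vanishing_differences_mult_const
        vanishing_differences_mono[OF vanishing_differences_power])
qed

text \<open>A multiset \<open>e\<close> of Frobenius exponents encodes a monomial as the product of
  the additive maps y^(p^l), l in \<open>e\<close>; \<open>size e\<close> then bounds the degree
  seen by iterated differences.\<close>

definition power_sum_of :: "nat \<Rightarrow> nat multiset \<Rightarrow> nat" where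
  "power_sum_of p e = (\<Sum>l\<in>#e. p ^ l)"

lemma power_sum_of_simps [simp]:
  "power_sum_of p {#} = 0" "power_sum_of p (add_mset l e) = p ^ l + power_sum_of p e"
  by (simp_all add: power_sum_of_def)

lemma power_CHAR_power_add:
  fixes x y :: "'b::comm_ring_1"
  assumes "prime CHAR('b)"
  shows "(x + y) ^ (CHAR('b) ^ l) = x ^ (CHAR('b) ^ l) + y ^ (CHAR('b) ^ l)"
  using assms by (rule freshmans_dream') simp

lemma vanishing_differences_power_sum_of:
  assumes "prime CHAR('b::comm_ring_1)"
  shows "vanishing_differences (Suc (size e)) (\<lambda>y::'b. y ^ power_sum_of CHAR('b) e)"
proof (induction e)
  case empty
  then show ?case by (simp add: vanishing_differences_Suc vanishing_differences_0 difference_def)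
next
  case (add l e)
  then show ?case
    using vanishing_differences_mult_additive[of "\<lambda>y. y ^ (CHAR('b) ^ l)", OF power_CHAR_power_add]
    by (simp add: assms power_add)
qed

text \<open>Expand the product over l in \<open>e\<close> of (y^(p^l) + u^(p^l)). The term without u
  cancels, the terms with u in exactly one factor form the subtracted sum, and those with u in two
  or more factors are products of at most \<open>size e - 2\<close> additive maps in y, which
  \<open>size e - 1\<close> differences annihilate.\<close>

lemma difference_power_sum_of:
  assumes char: "prime CHAR('b::comm_ring_1)"
  shows "vanishing_differences (size e - 1) (\<lambda>y::'b. difference u (\<lambda>y. y ^ power_sum_of CHAR('b) e) y -
     (\<Sum>l\<in>set_mset e. of_nat (count e l) * u ^ (CHAR('b) ^ l) * y ^ power_sum_of CHAR('b) (e - {#l#})))"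
proof (induction e)
  case empty
  then show ?case by (simp add: vanishing_differences_0 difference_def)
next
  case (add k e)
  let ?p = "CHAR('b)"
  define X where "X = (\<lambda>e y::'b. y ^ power_sum_of ?p e)"
  define h where "h = (\<lambda>y::'b. y ^ (?p ^ k))"
  define S where "S = (\<lambda>e y. \<Sum>l\<in>set_mset e. of_nat (count e l) * u ^ (?p ^ l) * X (e - {#l#}) y)"
  have hadd: "h (x + y) = h x + h y" for x y
    unfolding h_def by (rule power_CHAR_power_add[OF char])
  have X: "X (add_mset k e) y = h y * X e y" for e y
    by (simp add: X_def h_def power_add)
  \<comment> \<open>The subtracted sum obeys a Leibniz rule: the new factor for k either stays as
    \<open>h y\<close> or is the one that is evaluated at u.\<close>
  have S: "S (add_mset k e) y = h y * S e y + h u * X e y" for y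
  proof -
    let ?A = "set_mset (add_mset k e)"
    have "S (add_mset k e) y =
        (\<Sum>l\<in>?A. h y * (of_nat (count e l) * u ^ (?p ^ l) * X (e - {#l#}) y)
           + (if l = k then h u * X e y else 0))"
      unfolding S_def
    proof (rule sum.cong[OF refl])
      fix l assume "l \<in> ?A"
      show "of_nat (count (add_mset k e) l) * u ^ (?p ^ l) * X (add_mset k e - {#l#}) y
        = h y * (of_nat (count e l) * u ^ (?p ^ l) * X (e - {#l#}) y)
           + (if l = k then h u * X e y else 0)"
      proof (cases "l \<in># e")
        case True
        then have "add_mset k e - {#l#} = add_mset k (e - {#l#})"
          by (metis add_mset_add_single multiset_diff_union_assoc
              add.commute mset_subset_eq_single)
        then show ?thesis
          using X[of e] True
          by (auto simp: X h_def algebra_simps X_def power_add[symmetric])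
             (metis (no_types, lifting) insert_DiffM power_sum_of_simps(2) power_add)
      qed (use \<open>l \<in> ?A\<close> in \<open>auto simp: h_def not_in_iff\<close>)
    qed
    also have "\<dots> = h y * (\<Sum>l\<in>?A. of_nat (count e l) * u ^ (?p ^ l) * X (e - {#l#}) y) + h u * X e y"
      by (simp add: sum.distrib sum_distrib_left del: set_mset_add_mset_insert) auto
    also have "(\<Sum>l\<in>?A. of_nat (count e l) * u ^ (?p ^ l) * X (e - {#l#}) y) = S e y"
      unfolding S_def by (rule sum.mono_neutral_right) (auto simp: not_in_iff)
    finally show ?thesis .
  qed
  have IH: "vanishing_differences (size e - 1) (\<lambda>y. difference u (X e) y - S e y)"
    using add by (simp add: X_def S_def)
  have "vanishing_differences (size e) (\<lambda>y. difference u (X (add_mset k e)) y - S (add_mset k e) y)"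
  proof (cases "e = {#}")
    case True
    then show ?thesis
      by (simp add: vanishing_differences_0 difference_def S X hadd) (simp add: X_def S_def h_def)
  next
    case False
    then obtain s where s: "size e = Suc s" by (cases "size e") auto
    \<comment> \<open>The remainder for \<open>add_mset k e\<close> is \<open>h y\<close> times the
      remainder for \<open>e\<close>, plus \<open>h u\<close> times the difference of
      \<open>X e\<close>. The former gains one factor, the latter has lost one degree, and both land
      at \<open>size e\<close>.\<close>
    have "vanishing_differences (Suc (size e)) (X e)"
      unfolding X_def by (rule vanishing_differences_power_sum_of[OF char])
    then have "vanishing_differences (size e) (\<lambda>y. h u * difference u (X e) y)"
      by (auto simp: vanishing_differences_Suc intro: vanishing_differences_mult_const)
    moreover have "vanishing_differences (size e) (\<lambda>y. h y * (difference u (X e) y - S e y))"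
      using vanishing_differences_mult_additive[of h, OF hadd IH] s by simp
    moreover have "(\<lambda>y. difference u (X (add_mset k e)) y - S (add_mset k e) y)
        = (\<lambda>y. h u * difference u (X e) y + h y * (difference u (X e) y - S e y))"
      by (auto simp: difference_def S X hadd algebra_simps)
    ultimately show ?thesis by (simp add: vanishing_differences_add)
  qed
  then show ?case by (simp add: X_def S_def)
qed

section \<open>The symmetric multiadditive form of a monomial\<close>

definition multimonomial :: "'b::comm_semiring_1 list \<Rightarrow> nat list \<Rightarrow> 'b" where
  "multimonomial us \<alpha> = prod_list (map2 (^) us \<alpha>)"

lemma multimonomial_simps [simp]:
  "multimonomial us [] = 1" "multimonomial [] \<alpha> = 1"
  "multimonomial (u # us) (a # \<alpha>) = u ^ a * multimonomial us \<alpha>"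
  by (simp_all add: multimonomial_def)

text \<open>How often each distinct arrangement of \<open>e\<close> occurs among all (size e)!
  permutations of its entries.\<close>

definition multiplicity_factor :: "nat multiset \<Rightarrow> nat" where
  "multiplicity_factor e = (\<Prod>l\<in>set_mset e. fact (count e l))"

text \<open>The top difference of the monomial of \<open>e\<close>: the sum over all (size e)! ways
  to hand the exponents p^l to the variables. Equal terms are collected, so that the sum runs over
  distinct arrangements with one common coefficient, from which nonvanishing modulo a prime can be
  read off.\<close>

definition polarization :: "nat \<Rightarrow> nat multiset \<Rightarrow> 'b::comm_ring_1 list \<Rightarrow> 'b" where
  "polarization p e us = of_nat (multiplicity_factor e) *
     (\<Sum>\<tau>\<in>permutations_of_multiset e. multimonomial us (map ((^) p) \<tau>))"

lemma multiplicity_factor_add_mset: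
  "multiplicity_factor (add_mset l e) = Suc (count e l) * multiplicity_factor e"
proof -
  let ?A = "insert l (set_mset e)"
  have "multiplicity_factor e = (\<Prod>x\<in>?A. fact (count e x))"
    unfolding multiplicity_factor_def by (rule prod.mono_neutral_left) (auto simp: not_in_iff)
  also have "\<dots> = fact (count e l) * (\<Prod>x\<in>?A - {l}. fact (count e x))"
    by (rule prod.remove) auto
  finally have 1: "multiplicity_factor e = fact (count e l) * (\<Prod>x\<in>?A - {l}. fact (count e x))" .
  have "multiplicity_factor (add_mset l e)
      = fact (count (add_mset l e) l) * (\<Prod>x\<in>?A - {l}. fact (count (add_mset l e) x))"
    unfolding multiplicity_factor_def set_mset_add_mset_insert by (rule prod.remove) auto
  also have "(\<Prod>x\<in>?A - {l}. fact (count (add_mset l e) x)) = (\<Prod>x\<in>?A - {l}. fact (count e x))"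
    by (rule prod.cong) auto
  finally show ?thesis by (simp add: 1 algebra_simps)
qed

text \<open>Arrangements are sorted by their first entry l; removing l divides the multiplicity
  factor by exactly \<open>count e l\<close>.\<close>

lemma polarization_Cons:
  assumes "e \<noteq> {#}"
  shows "polarization p e (u # us) =
    (\<Sum>l\<in>set_mset e. of_nat (count e l) * u ^ (p ^ l) * polarization p (e - {#l#}) us)"
proof -
  have "(\<Sum>\<tau>\<in>permutations_of_multiset e. multimonomial (u # us) (map ((^) p) \<tau>)) =
     (\<Sum>l\<in>set_mset e. \<Sum>\<tau>\<in>(#) l ` permutations_of_multiset (e - {#l#}).
        multimonomial (u # us) (map ((^) p) \<tau>))"
    unfolding permutations_of_multiset_nonempty[OF assms]
    by (rule sum.UNION_disjoint) auto
  also have "\<dots> = (\<Sum>l\<in>set_mset e. u ^ (p ^ l) *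
        (\<Sum>\<tau>\<in>permutations_of_multiset (e - {#l#}). multimonomial us (map ((^) p) \<tau>)))"
    by (simp add: sum.reindex sum_distrib_left)
  finally have "polarization p e (u # us) = (\<Sum>l\<in>set_mset e. of_nat (multiplicity_factor e) * (u ^ (p ^ l) *
        (\<Sum>\<tau>\<in>permutations_of_multiset (e - {#l#}). multimonomial us (map ((^) p) \<tau>))))"
    by (simp add: polarization_def sum_distrib_left)
  also have "\<dots> = (\<Sum>l\<in>set_mset e. of_nat (count e l) * u ^ (p ^ l) * polarization p (e - {#l#}) us)"
  proof (rule sum.cong[OF refl])
    fix l assume "l \<in># e"
    then obtain e' where e: "e = add_mset l e'" by (metis insert_DiffM)
    have "multiplicity_factor e = count e l * multiplicity_factor e'"
      by (simp add: e multiplicity_factor_add_mset)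
    then have m: "of_nat (multiplicity_factor e)
        = (of_nat (count e l) * of_nat (multiplicity_factor e') :: 'a)"
      by (metis of_nat_mult)
    have e': "e - {#l#} = e'" by (simp add: e)
    show "of_nat (multiplicity_factor e) * (u ^ (p ^ l) *
        (\<Sum>\<tau>\<in>permutations_of_multiset (e - {#l#}). multimonomial us (map ((^) p) \<tau>)))
       = of_nat (count e l) * u ^ (p ^ l) * polarization p (e - {#l#}) us"
      unfolding m e' polarization_def by (simp add: mult_ac)
  qed
  finally show ?thesis .
qed

text \<open>The first difference is replaced by its leading sum, and the remaining
  \<open>size e - 1\<close> differences kill the error exactly. Hence the result does not depend on
  the base point \<open>y\<close>.\<close>

lemma fold_difference_power_sum_of:
  assumes char: "prime CHAR('b::comm_ring_1)"
  shows "size e = length us \<Longrightarrow>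
    fold difference us (\<lambda>y::'b. y ^ power_sum_of CHAR('b) e) y = polarization CHAR('b) e us"
proof (induction us arbitrary: e y)
  case Nil
  then show ?case by (simp add: polarization_def multiplicity_factor_def)
next
  case (Cons u us)
  let ?p = "CHAR('b)"
  let ?X = "\<lambda>e y::'b. y ^ power_sum_of ?p e"
  let ?c = "\<lambda>l. of_nat (count e l) * u ^ (?p ^ l)"
  have ne: "e \<noteq> {#}" using Cons.prems by auto
  have "fold difference us (\<lambda>y. (difference u (?X e) y - (\<Sum>l\<in>set_mset e. ?c l * ?X (e - {#l#}) y))
          + (\<Sum>l\<in>set_mset e. ?c l * ?X (e - {#l#}) y)) y
      = (\<Sum>l\<in>set_mset e. ?c l * fold difference us (?X (e - {#l#})) y)"
    using difference_power_sum_of[OF char, of e u] Cons.prems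
    by (subst fold_difference_add)
       (simp add: vanishing_differences_def fold_difference_sum
         fold_difference_additive[of "(*) (_ * _)"] distrib_left)
  also have "\<dots> = (\<Sum>l\<in>set_mset e. ?c l * polarization ?p (e - {#l#}) us)"
    using Cons.prems by (intro sum.cong refl arg_cong2[of _ _ _ _ "(*)"] Cons.IH) (simp add: size_Diff_singleton)
  also have "\<dots> = polarization ?p e (u # us)"
    by (simp add: polarization_Cons[OF ne])
  finally show ?case by (simp add: difference_def[abs_def])
qed

section \<open>A Schwartz--Zippel bound and base-p digits\<close>

lemma multimonomial_power:
  "multimonomial us \<alpha> ^ n = multimonomial us (map ((*) n) \<alpha>)"
proof (induction \<alpha> arbitrary: us)
  case (Cons a \<alpha>)
  then show ?case by (cases us) (auto simp: power_mult_distrib power_mult mult.commute[of n])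
qed simp

text \<open>Linear factors modulo \<pi> are split off by synthetic division, each costing one fibre
  of at most \<open>N\<close> points. Nonvanishing modulo \<pi> is recorded by some coefficient
  \<open>a\<close>, since the leading one may be divisible by \<pi>.\<close>

lemma card_roots_mod:
  fixes q :: "'b::comm_ring_1 poly"
  assumes prime: "\<And>a b. \<pi> dvd a * b \<Longrightarrow> \<pi> dvd a \<or> \<pi> dvd b"
    and fin: "finite S" and fibre: "\<And>v. card {x \<in> S. \<pi> dvd x - v} \<le> N"
  shows "\<not> \<pi> dvd coeff q a \<Longrightarrow> degree q \<le> D \<Longrightarrow> card {x \<in> S. \<pi> dvd poly q x} \<le> D * N"
proof (induction D arbitrary: q a)
  case 0
  then obtain c where q: "q = [:c:]" by (auto elim: degree_eq_zeroE)
  then have "\<not> \<pi> dvd c" using 0(1) by (cases a) auto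
  then show ?case by (simp add: q)
next
  case (Suc D)
  show ?case
  proof (cases "\<exists>c\<in>S. \<pi> dvd poly q c")
    case True
    then obtain c where c: "c \<in> S" "\<pi> dvd poly q c" by auto
    define q' where "q' = synthetic_div q c"
    have q: "q = [:- c, 1:] * q' + [:poly q c:]"
      unfolding q'_def by (rule synthetic_div_correct'[symmetric])
    have "\<exists>a'. \<not> \<pi> dvd coeff q' a'"
    proof (rule ccontr)
      assume "\<not> ?thesis"
      then have "\<pi> dvd coeff ([:- c, 1:] * q' + [:poly q c:]) a"
        using c(2) by (cases a) (auto simp: coeff_pCons)
      then show False using Suc.prems(1) q by metis
    qed
    then obtain a' where a': "\<not> \<pi> dvd coeff q' a'" ..
    have "degree q' \<le> D"
      using Suc.prems by (simp add: q'_def degree_synthetic_div)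
    then have IH: "card {x \<in> S. \<pi> dvd poly q' x} \<le> D * N"
      using Suc.IH[OF a'] by simp
    have "{x \<in> S. \<pi> dvd poly q x} \<subseteq> {x \<in> S. \<pi> dvd x - c} \<union> {x \<in> S. \<pi> dvd poly q' x}"
    proof
      fix x assume x: "x \<in> {x \<in> S. \<pi> dvd poly q x}"
      have "poly q x = (x - c) * poly q' x + poly q c"
        by (subst q) (simp add: algebra_simps)
      then have "\<pi> dvd (x - c) * poly q' x"
        using x c(2) by (metis (no_types, lifting) dvd_add_left_iff mem_Collect_eq)
      then show "x \<in> {x \<in> S. \<pi> dvd x - c} \<union> {x \<in> S. \<pi> dvd poly q' x}"
        using prime x by blast
    qed
    then have "card {x \<in> S. \<pi> dvd poly q x}
        \<le> card ({x \<in> S. \<pi> dvd x - c} \<union> {x \<in> S. \<pi> dvd poly q' x})"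
      using fin by (intro card_mono) auto
    also have "\<dots> \<le> N + D * N"
      using fibre[of c] IH by (meson add_mono card_Un_le order_trans)
    finally show ?thesis by simp
  next
    case False
    then have "{x \<in> S. \<pi> dvd poly q x} = {}" by auto
    then show ?thesis by (simp only: card.empty)
  qed
qed

text \<open>
  A Schwartz--Zippel bound in \<open>R/\<pi>\<close>, for sample points in a set whose fibres over \<open>R/\<pi>\<close> have
  at most \<open>N\<close> elements; \<open>\<pi> = 0\<close> is allowed in an integral domain.
\<close>

lemma card_multimonomial_roots_mod:
  fixes C :: "nat list \<Rightarrow> 'b::comm_ring_1"
  assumes prime: "\<And>a b. \<pi> dvd a * b \<Longrightarrow> \<pi> dvd a \<or> \<pi> dvd b"
    and fin: "finite S" and fibre: "\<And>v. card {x \<in> S. \<pi> dvd x - v} \<le> N"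
  shows "finite T \<Longrightarrow> (\<And>\<alpha>. \<alpha> \<in> T \<Longrightarrow> length \<alpha> = m \<and> set \<alpha> \<subseteq> {..D}) \<Longrightarrow> \<gamma> \<in> T \<Longrightarrow> \<not> \<pi> dvd C \<gamma>
   \<Longrightarrow> card {us. set us \<subseteq> S \<and> length us = m \<and> \<pi> dvd (\<Sum>\<alpha>\<in>T. C \<alpha> * multimonomial us \<alpha>)}
     \<le> m * D * N * card S ^ (m - 1)"
proof (induction m arbitrary: T C \<gamma>)
  case 0
  then have "T = {[]}" "\<gamma> = []" by force+
  then show ?case using 0 by simp
next
  case (Suc m)
  define L where "L = {us. set us \<subseteq> S \<and> length us = m}"
  have L: "finite L" "card L = card S ^ m"
    using fin by (simp_all add: L_def finite_lists_length_eq card_lists_length_eq)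
  obtain a0 \<beta>0 where \<gamma>: "\<gamma> = a0 # \<beta>0"
    using Suc.prems(2)[OF Suc.prems(3)] by (cases \<gamma>) auto
  \<comment> \<open>Monomials are sorted by the exponent \<open>a\<close> of the first variable: for
    fixed remaining variables \<open>us\<close> the form is a polynomial \<open>q us\<close> in that
    variable.\<close>
  define T' where "T' a = {\<beta>. a # \<beta> \<in> T}" for a
  have finT': "finite (T' a)" for a
    using Suc.prems(1) by (auto simp: T'_def intro!: finite_subset[OF _ finite_imageI[of T tl]] image_eqI[of _ tl "a # _"])
  define K where "K a us = (\<Sum>\<beta>\<in>T' a. C (a # \<beta>) * multimonomial us \<beta>)" for a us
  define q where "q us = (\<Sum>a\<le>D. monom (K a us) a)" for us
  have coeff_q: "coeff (q us) a = (if a \<le> D then K a us else 0)" for us a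
    by (simp add: q_def coeff_sum coeff_monom)
  have deg_q: "degree (q us) \<le> D" for us
    by (rule degree_le) (simp add: coeff_q)
  have a0: "a0 \<le> D" using Suc.prems(2)[OF Suc.prems(3)] by (simp add: \<gamma>)
  have eval: "(\<Sum>\<alpha>\<in>T. C \<alpha> * multimonomial (u # us) \<alpha>) = poly (q us) u" for u us
  proof -
    have T: "T = (\<Union>a\<in>{..D}. (#) a ` T' a)"
    proof
      show "T \<subseteq> (\<Union>a\<in>{..D}. (#) a ` T' a)"
      proof
        fix \<alpha> assume "\<alpha> \<in> T"
        then show "\<alpha> \<in> (\<Union>a\<in>{..D}. (#) a ` T' a)"
          using Suc.prems(2)[of \<alpha>] by (cases \<alpha>) (auto simp: T'_def)
      qed
    qed (auto simp: T'_def)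
    have "(\<Sum>\<alpha>\<in>T. C \<alpha> * multimonomial (u # us) \<alpha>)
        = (\<Sum>a\<le>D. \<Sum>\<alpha>\<in>(#) a ` T' a. C \<alpha> * multimonomial (u # us) \<alpha>)"
      by (subst T, rule sum.UNION_disjoint) (auto simp: finT')
    also have "\<dots> = (\<Sum>a\<le>D. K a us * u ^ a)"
      by (simp add: sum.reindex K_def sum_distrib_left sum_distrib_right mult_ac)
    finally show ?thesis by (simp add: q_def poly_sum poly_monom)
  qed
  \<comment> \<open>\<open>B\<close> holds the tails at which the coefficient of u^a0 dies modulo
    \<pi>; the induction hypothesis bounds their number, and each admits at most
    \<open>card S\<close> heads. Any other tail admits at most \<open>D * N\<close> heads.\<close>
  define B where "B = {us \<in> L. \<pi> dvd K a0 us}"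
  have "B = {us. set us \<subseteq> S \<and> length us = m \<and>
      \<pi> dvd (\<Sum>\<beta>\<in>T' a0. C (a0 # \<beta>) * multimonomial us \<beta>)}"
    by (auto simp: B_def L_def K_def)
  moreover have "card \<dots> \<le> m * D * N * card S ^ (m - 1)"
  proof (rule Suc.IH)
    show "\<beta>0 \<in> T' a0" "\<not> \<pi> dvd C (a0 # \<beta>0)"
      using Suc.prems \<gamma> by (auto simp: T'_def)
    show "length \<beta> = m \<and> set \<beta> \<subseteq> {..D}" if "\<beta> \<in> T' a0" for \<beta>
      using Suc.prems(2)[of "a0 # \<beta>"] that by (auto simp: T'_def)
  qed (rule finT')
  ultimately have cB: "card B \<le> m * D * N * card S ^ (m - 1)" by simp
  let ?G = "{us. set us \<subseteq> S \<and> length us = Suc m \<and> \<pi> dvd (\<Sum>\<alpha>\<in>T. C \<alpha> * multimonomial us \<alpha>)}"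
  let ?A1 = "(\<lambda>(us, u). u # us) ` (B \<times> S)"
  let ?A2 = "(\<lambda>(us, u). u # us) ` (SIGMA us:L - B. {u \<in> S. \<pi> dvd poly (q us) u})"
  have sub: "?G \<subseteq> ?A1 \<union> ?A2"
  proof
    fix vs assume vs: "vs \<in> ?G"
    then obtain u us where u: "vs = u # us" "u \<in> S" "us \<in> L"
      by (cases vs) (auto simp: L_def)
    then show "vs \<in> ?A1 \<union> ?A2"
      using vs by (cases "us \<in> B") (auto simp: eval image_iff)
  qed
  have "finite B" using L by (simp add: B_def)
  have "card ?A1 \<le> card B * card S"
    using fin \<open>finite B\<close> by (metis card_cartesian_product card_image_le finite_cartesian_product)
  also have "\<dots> \<le> m * D * N * card S ^ (m - 1) * card S"
    using cB by simp
  also have "\<dots> = m * D * N * card S ^ m"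
    by (cases m) simp_all
  finally have 1: "card ?A1 \<le> m * D * N * card S ^ m" .
  have "card ?A2 \<le> card (SIGMA us:L - B. {u \<in> S. \<pi> dvd poly (q us) u})"
    using L fin by (intro card_image_le finite_SigmaI) auto
  also have "\<dots> = (\<Sum>us\<in>L - B. card {u \<in> S. \<pi> dvd poly (q us) u})"
    using L fin by (intro card_SigmaI) auto
  also have "\<dots> \<le> (\<Sum>us\<in>L - B. D * N)"
  proof (rule sum_mono)
    fix us assume "us \<in> L - B"
    then have "\<not> \<pi> dvd coeff (q us) a0" using a0 by (simp add: coeff_q B_def)
    then show "card {u \<in> S. \<pi> dvd poly (q us) u} \<le> D * N"
      using deg_q by (intro card_roots_mod[OF prime fin fibre])
  qed
  also have "\<dots> \<le> card S ^ m * (D * N)"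
    using L by (simp add: card_mono flip: L(2))
  finally have 2: "card ?A2 \<le> card S ^ m * (D * N)" .
  have "finite (?A1 \<union> ?A2)" using L fin \<open>finite B\<close> by auto
  then have "card ?G \<le> card (?A1 \<union> ?A2)" using sub by (rule card_mono)
  also have "\<dots> \<le> card ?A1 + card ?A2" by (rule card_Un_le)
  also have "\<dots> \<le> m * D * N * card S ^ m + card S ^ m * (D * N)" using 1 2 by simp
  finally show ?case by (simp add: algebra_simps)
qed

text \<open>Injectivity of \<open>E\<close> keeps the coefficients of different terms from being
  added up, so that a single coefficient not divisible by \<pi> suffices.\<close>

corollary card_indexed_multimonomial_roots_mod:
  fixes C :: "'i \<Rightarrow> 'b::comm_ring_1"
  assumes prime: "\<And>a b. \<pi> dvd a * b \<Longrightarrow> \<pi> dvd a \<or> \<pi> dvd b"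
    and fin: "finite S" and fibre: "\<And>v. card {x \<in> S. \<pi> dvd x - v} \<le> N"
    and J: "finite J" "inj_on E J" "\<And>t. t \<in> J \<Longrightarrow> length (E t) = m \<and> set (E t) \<subseteq> {..D}"
    and t: "t \<in> J" "\<not> \<pi> dvd C t"
  shows "card {us. set us \<subseteq> S \<and> length us = m \<and> \<pi> dvd (\<Sum>t\<in>J. C t * multimonomial us (E t))}
     \<le> m * D * N * card S ^ (m - 1)"
proof -
  have "(\<Sum>t\<in>J. C t * multimonomial us (E t))
      = (\<Sum>\<alpha>\<in>E ` J. C (the_inv_into J E \<alpha>) * multimonomial us \<alpha>)" for us
    using J(2) by (simp add: sum.reindex the_inv_into_f_f)
  moreover have "\<not> \<pi> dvd C (the_inv_into J E (E t))"
    using J(2) t by (simp add: the_inv_into_f_f)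
  ultimately show ?thesis
    using card_multimonomial_roots_mod[OF prime fin fibre, of "E ` J" m D "E t"
        "\<lambda>\<alpha>. C (the_inv_into J E \<alpha>)"] J t
    by auto
qed

text \<open>The exponent l occurs as often as the digit at p^l says, so \<open>size\<close> is the
  base-p digit sum. The default \<open>{#}\<close> for p \<le> 1 covers p = 1, where
  \<open>n div p\<close> does not decrease.\<close>

function digit_multiset :: "nat \<Rightarrow> nat \<Rightarrow> nat multiset" where
  "digit_multiset p n = (if n = 0 \<or> p \<le> 1 then {#}
     else replicate_mset (n mod p) 0 + image_mset Suc (digit_multiset p (n div p)))"
  by auto
termination by (relation "measure snd") auto

declare digit_multiset.simps [simp del]

lemma power_sum_of_image_Suc: "power_sum_of p (image_mset Suc e) = p * power_sum_of p e"
  by (induction e) (auto simp: algebra_simps)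

lemma power_sum_of_union: "power_sum_of p (e + e') = power_sum_of p e + power_sum_of p e'"
  by (induction e) (auto simp: algebra_simps)

lemma power_sum_of_replicate_0: "power_sum_of p (replicate_mset n 0) = n"
  by (induction n) auto

lemma power_sum_of_digit_multiset:
  "p > 1 \<Longrightarrow> power_sum_of p (digit_multiset p n) = n"
proof (induction p n rule: digit_multiset.induct)
  case (1 p n)
  then show ?case
    by (subst digit_multiset.simps)
       (auto simp: power_sum_of_union power_sum_of_image_Suc power_sum_of_replicate_0)
qed

lemma count_digit_multiset_less:
  "p > 1 \<Longrightarrow> count (digit_multiset p n) l < p"
proof (induction p n arbitrary: l rule: digit_multiset.induct)
  case (1 p n)
  have "count (image_mset Suc e) 0 = 0" "count (image_mset Suc e) (Suc k) = count e k" for e k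
    by (induction e) auto
  then show ?case using 1
    by (subst digit_multiset.simps) (cases l; auto)
qed

text \<open>The digits are shifted by j places. Thus all exponents p^j * r_i occurring in one
  summand of P have the digit sum of r_i.\<close>

lemma size_digit_multiset_power_mult:
  "p > 1 \<Longrightarrow> size (digit_multiset p (p ^ j * n)) = size (digit_multiset p n)"
proof (induction j)
  case (Suc j)
  have "size (digit_multiset p (p * m)) = size (digit_multiset p m)" for m
    using Suc.prems by (subst digit_multiset.simps) (auto simp: digit_multiset.simps[of p 0])
  from this[of "p ^ j * n"] show ?case using Suc by (simp add: mult.assoc)
qed simp

lemma le_power_sum_of: "l \<in># e \<Longrightarrow> p ^ l \<le> power_sum_of p e"
  by (metis insert_DiffM le_add1 power_sum_of_simps(2))

lemma dvd_power_sum_of: "0 \<notin># e \<Longrightarrow> p dvd power_sum_of p e"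
proof (induction e)
  case (add l e)
  then show ?case by (cases l) auto
qed simp

lemma multiplicity_factor_not_dvd:
  assumes "prime p" "\<And>l. count e l < p"
  shows "\<not> p dvd multiplicity_factor e"
  using assms unfolding multiplicity_factor_def
  by (auto simp: prime_dvd_prod_iff prime_dvd_fact_iff not_le[symmetric])

lemma sum_list_map_power: "sum_list (map ((^) p) \<tau>) = power_sum_of p (mset \<tau>)"
  by (induction \<tau>) auto

text \<open>Suppose digit sums above \<open>K\<close> occur and let s be the largest. The s-fold
  difference at 0 is the sum of the polarizations of the terms with digit sum s, a polynomial in the
  directions with distinct monomials and nonzero coefficients. Yet it vanishes everywhere, which on
  a large finite set contradicts the root bound with \<pi> = 0.\<close>

lemma size_digit_multiset_le:
  fixes P :: "'b::idom poly"
  assumes char: "prime CHAR('b)" and inf: "infinite (UNIV :: 'b set)"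
    and van: "vanishing_differences (Suc K) (poly P)" and n: "coeff P n \<noteq> 0"
  shows "size (digit_multiset CHAR('b) n) \<le> K"
proof (rule ccontr)
  assume large: "\<not> ?thesis"
  let ?p = "CHAR('b)"
  let ?e = "digit_multiset ?p"
  define A where "A = {n. coeff P n \<noteq> 0}"
  have "finite A" unfolding A_def using MOST_coeff_eq_0[of P] by (simp add: eventually_cofinite)
  define s where "s = Max ((\<lambda>n. size (?e n)) ` A)"
  have s_ge: "size (?e i) \<le> s" if "i \<in> A" for i
    unfolding s_def using \<open>finite A\<close> that by simp
  have "s \<in> (\<lambda>n. size (?e n)) ` A"
    unfolding s_def using \<open>finite A\<close> n by (intro Max_in) (auto simp: A_def)
  then obtain n1 where n1: "n1 \<in> A" "size (?e n1) = s" by auto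
  have "s > K" using s_ge[of n] n large by (simp add: A_def)
  have p: "?p > 1" using prime_gt_1_nat[OF char] .
  have vans: "vanishing_differences s (poly P)"
    using vanishing_differences_mono[OF van, of s] \<open>s > K\<close> by simp
  define J where "J = (SIGMA n:{n \<in> A. size (?e n) = s}. permutations_of_multiset (?e n))"
  define E where "E = (\<lambda>(n::nat, \<tau>). map ((^) ?p) \<tau>)"
  define C where "C = (\<lambda>(n, \<tau>::nat list). coeff P n * of_nat (multiplicity_factor (?e n)))"
  have finJ: "finite J" unfolding J_def using \<open>finite A\<close> by (intro finite_SigmaI) auto
  have zero: "(\<Sum>t\<in>J. C t * multimonomial us (E t)) = 0" if us: "length us = s" for us
  proof -
    have "poly P = (\<lambda>y. \<Sum>i\<in>A. coeff P i * y ^ power_sum_of ?p (?e i))"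
      unfolding poly_altdef power_sum_of_digit_multiset[OF p]
      by (intro ext sum.mono_neutral_right) (auto simp: A_def le_degree)
    then have "fold difference us (poly P) 0 =
        (\<Sum>i\<in>A. coeff P i * fold difference us (\<lambda>y. y ^ power_sum_of ?p (?e i)) 0)"
      by (simp add: fold_difference_sum fold_difference_additive[of "(*) (coeff P _)"] distrib_left)
    also have "\<dots> = (\<Sum>i\<in>{n \<in> A. size (?e n) = s}. coeff P i * polarization ?p (?e i) us)"
    proof (rule sum.mono_neutral_cong_right[OF \<open>finite A\<close>])
      show "\<forall>i\<in>A - {n \<in> A. size (?e n) = s}.
          coeff P i * fold difference us (\<lambda>y. y ^ power_sum_of ?p (?e i)) 0 = 0"
      proof
        fix i assume "i \<in> A - {n \<in> A. size (?e n) = s}"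
        then have "Suc (size (?e i)) \<le> s" using s_ge[of i] by auto
        then show "coeff P i * fold difference us (\<lambda>y. y ^ power_sum_of ?p (?e i)) 0 = 0"
          using vanishing_differences_mono[OF vanishing_differences_power_sum_of[OF char]] us
          unfolding vanishing_differences_def by (metis mult_zero_right)
      qed
    qed (auto simp: us fold_difference_power_sum_of[OF char])
    also have "\<dots> = (\<Sum>t\<in>J. C t * multimonomial us (E t))"
      using \<open>finite A\<close>
      by (simp add: J_def C_def E_def polarization_def sum_distrib_left sum.Sigma mult.assoc)
         (auto intro!: sum.cong)
    finally show ?thesis using vans us by (simp add: vanishing_differences_def)
  qed
  \<comment> \<open>A crude common bound for all exponents. The choice
    \<open>card S = s * D + 1\<close> below makes \<open>s * D * card S ^ (s - 1)\<close> smaller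
    than \<open>card S ^ s\<close>.\<close>
  define D where "D = (\<Sum>t\<in>J. sum_list (E t))"
  have leD: "set (E t) \<subseteq> {..D}" if "t \<in> J" for t
  proof
    fix a assume "a \<in> set (E t)"
    then have "a \<le> sum_list (E t)" by (intro member_le_sum_list) auto
    also have "\<dots> \<le> D" unfolding D_def using finJ that by (intro member_le_sum) auto
    finally show "a \<in> {..D}" by simp
  qed
  obtain S :: "'b set" where S: "finite S" "card S = s * D + 1"
    using inf by (metis infinite_arbitrarily_large)
  obtain \<tau> where \<tau>: "\<tau> \<in> permutations_of_multiset (?e n1)"
    using permutations_of_multiset_not_empty by blast
  have len: "length \<tau> = size e" if "\<tau> \<in> permutations_of_multiset e" for \<tau> :: "nat list" and e
    using permutations_of_multisetD[OF that] by (metis size_mset)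
  have inj: "inj_on E J"
  proof (rule inj_onI)
    fix t t' assume t: "t \<in> J" "t' \<in> J" "E t = E t'"
    \<comment> \<open>The total degree of a monomial is the sum of p^l over the digits of n, which
      is n itself.\<close>
    have "sum_list (E x) = fst x" if "x \<in> J" for x
      using that p by (auto simp: J_def E_def sum_list_map_power permutations_of_multiset_def
          power_sum_of_digit_multiset)
    then have "fst t = fst t'" using t by metis
    moreover have "snd t = snd t'"
      using t p unfolding E_def by (auto simp: case_prod_beta inj_map_eq_map inj_def)
    ultimately show "t = t'" by (simp add: prod_eq_iff)
  qed
  have "card {us. set us \<subseteq> S \<and> length us = s \<and> 0 dvd (\<Sum>t\<in>J. C t * multimonomial us (E t))}
     \<le> s * D * 1 * card S ^ (s - 1)"
  proof (rule card_indexed_multimonomial_roots_mod[OF _ S(1) _ finJ inj])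
    show "card {x \<in> S. 0 dvd x - v} \<le> 1" for v
      by (rule card_le_Suc0_iff_eq[THEN iffD2, unfolded One_nat_def[symmetric]]) (use S in auto)
    show "length (E t) = s \<and> set (E t) \<subseteq> {..D}" if "t \<in> J" for t
      using leD[OF that] that len by (auto simp: J_def E_def)
    show "(n1, \<tau>) \<in> J" using n1 \<tau> by (simp add: J_def)
    have "of_nat (multiplicity_factor (?e n1)) \<noteq> (0 :: 'b)"
      using multiplicity_factor_not_dvd[OF char count_digit_multiset_less[OF p]]
      by (simp add: of_nat_eq_0_iff_char_dvd)
    then show "\<not> 0 dvd C (n1, \<tau>)" using n1 by (simp add: C_def A_def)
  qed auto
  moreover have "{us. set us \<subseteq> S \<and> length us = s \<and> 0 dvd (\<Sum>t\<in>J. C t * multimonomial us (E t))}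
      = {us. set us \<subseteq> S \<and> length us = s}"
    using zero by auto
  ultimately have "card S ^ s \<le> s * D * card S ^ (s - 1)"
    using S by (simp add: card_lists_length_eq)
  also have "\<dots> < card S * card S ^ (s - 1)" using S by simp
  also have "\<dots> = card S ^ s" using \<open>s > K\<close> by (cases s) auto
  finally show False by simp
qed

section \<open>Laurent series and additive polynomials\<close>

lemma laurent_of_poly_pCons:
  "laurent_of_poly (pCons a q) = fls_const a + fls_X_inv * laurent_of_poly q"
  by (simp add: laurent_of_poly_def map_poly_pCons)

lemma laurent_of_poly_0 [simp]: "laurent_of_poly 0 = 0"
  by (simp add: laurent_of_poly_def)

lemma laurent_of_poly_add: "laurent_of_poly (a + b) = laurent_of_poly a + laurent_of_poly b"
proof (induction a b rule: poly_induct2)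
  case (pCons a p b q)
  then show ?case by (simp add: laurent_of_poly_pCons algebra_simps flip: fls_plus_const)
qed simp

lemma laurent_of_poly_smult: "laurent_of_poly (smult c a) = fls_const c * laurent_of_poly a"
  by (induction a) (simp_all add: laurent_of_poly_pCons algebra_simps)

lemma laurent_of_poly_mult: "laurent_of_poly (a * b) = laurent_of_poly a * laurent_of_poly b"
proof (induction a)
  case (pCons c a)
  then show ?case
    by (simp add: laurent_of_poly_add laurent_of_poly_smult laurent_of_poly_pCons algebra_simps)
qed simp

lemma laurent_of_poly_nth:
  "fls_nth (laurent_of_poly a) k = (if k \<le> 0 then coeff a (nat (- k)) else 0)"
proof (induction a arbitrary: k)
  case (pCons c a)
  show ?case
    by (cases "nat (- k)")
       (auto simp: laurent_of_poly_pCons fls_X_inv_times_conv_shift pCons.IH nat_diff_distrib)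
qed simp

lemma laurent_of_poly_eq_0_iff: "laurent_of_poly a = 0 \<longleftrightarrow> a = 0"
proof
  assume "laurent_of_poly a = 0"
  then have "coeff a n = 0" for n using laurent_of_poly_nth[of a "- int n"] by simp
  then show "a = 0" by (simp add: poly_eq_iff)
qed simp

lemma poly_map_poly_laurent_of_poly:
  "poly (map_poly laurent_of_poly P) (laurent_of_poly x) = laurent_of_poly (poly P x)"
  by (induction P) (simp_all add: map_poly_pCons laurent_of_poly_add laurent_of_poly_mult)

lemma fold_difference_semiconj:
  assumes add: "\<And>x y. \<phi> (x + y) = \<phi> x + \<phi> y" and g: "\<And>x. g' (\<phi> x) = \<phi> (g x)"
  shows "fold difference (map \<phi> us) g' (\<phi> y) = \<phi> (fold difference us g y)"
proof -
  have "\<phi> (x - y) = \<phi> x - \<phi> y" for x y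
    using add[of "x - y" y] by (simp add: algebra_simps)
  then have "\<forall>x. g' (\<phi> x) = \<phi> (g x) \<Longrightarrow>
      fold difference (map \<phi> us) g' (\<phi> y) = \<phi> (fold difference us g y)" for g g'
    by (induction us arbitrary: g g') (simp_all add: difference_def add[symmetric])
  then show ?thesis using g by blast
qed

text \<open>The least value exists because degree + 1 differences annihilate any polynomial
  function. Specializing directions and base point to the copy of F[t] in the Laurent series, and
  using that the embedding is injective, brings the vanishing back to F[t].\<close>

lemma vanishing_differences_derivational_degree:
  "vanishing_differences (Suc (derivational_degree P)) (poly P)"
proof -
  let ?P = "map_poly laurent_of_poly P"
  let ?van = "\<lambda>d'. \<forall>us. length us = d' + 1 \<longrightarrow> (\<forall>y. fold difference us (poly ?P) y = 0)"
  have "?van (degree ?P)"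
    using vanishing_differences_poly[of ?P] by (simp add: vanishing_differences_def)
  then have "?van (derivational_degree P)"
    unfolding derivational_degree_def by (rule LeastI)
  moreover have "fold difference (map laurent_of_poly us) (poly ?P) (laurent_of_poly y)
      = laurent_of_poly (fold difference us (poly P) y)" for us y
    by (rule fold_difference_semiconj)
       (simp_all add: laurent_of_poly_add poly_map_poly_laurent_of_poly)
  ultimately show ?thesis
    unfolding vanishing_differences_def
    by (metis Suc_eq_plus1 length_map laurent_of_poly_eq_0_iff)
qed

section \<open>Exponents of additive polynomials\<close>

lemma poly_add_of_additive_poly:
  fixes \<eta> :: "'b::comm_ring_1 poly"
  assumes "additive_poly \<eta>"
  shows "poly \<eta> (x + v) = poly \<eta> x + poly \<eta> v"
proof -
  have *: "poly (map_poly (\<lambda>c. [:c:]) \<eta>) [:v:] = [:poly \<eta> v:]" for v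
    by (induction \<eta>) (simp_all add: map_poly_pCons)
  have "poly (poly (map_poly (\<lambda>c. [:c:]) \<eta>) q) x = poly \<eta> (poly q x)" for q
    by (induction \<eta>) (simp_all add: map_poly_pCons)
  then have "poly (poly (pcompose (map_poly (\<lambda>c. [:c:]) \<eta>) [:[:0, 1:], 1:]) [:v:]) x = poly \<eta> (x + v)"
    by (simp add: poly_pcompose add.commute)
  moreover have "poly (poly ([:\<eta>:] + map_poly (\<lambda>c. [:c:]) \<eta>) [:v:]) x = poly \<eta> x + poly \<eta> v"
    by (simp add: *)
  ultimately show ?thesis using assms by (simp add: additive_poly_def)
qed

text \<open>An additive function has vanishing second differences, so its exponents have digit sum
  at most 1; digit sum 0 belongs to the constant term, which is 0 because \<eta>(0) = 0.\<close>

lemma additive_poly_exponent: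
  fixes \<eta> :: "'b::idom poly"
  assumes char: "prime CHAR('b)" and inf: "infinite (UNIV :: 'b set)"
    and add: "additive_poly \<eta>" and n: "coeff \<eta> n \<noteq> 0"
  shows "\<exists>j. n = CHAR('b) ^ j"
proof -
  let ?p = "CHAR('b)"
  note \<eta> = poly_add_of_additive_poly[OF add]
  have "vanishing_differences (Suc 1) (poly \<eta>)"
    by (simp add: vanishing_differences_Suc vanishing_differences_0 difference_def \<eta>)
  then have "size (digit_multiset ?p n) \<le> 1"
    by (rule size_digit_multiset_le[OF char inf _ n])
  moreover have "n = power_sum_of ?p (digit_multiset ?p n)"
    using power_sum_of_digit_multiset[OF prime_gt_1_nat[OF char]] by simp
  moreover have "n \<noteq> 0"
    using n \<eta>[of 0 0] by (metis add_cancel_right_right add_0 poly_0_coeff_0)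
  ultimately have "size (digit_multiset ?p n) = 1"
    by (cases "digit_multiset ?p n") auto
  then obtain j where "digit_multiset ?p n = {#j#}" using size_1_singleton_mset by blast
  then show ?thesis using \<open>n = power_sum_of ?p _\<close> by (metis power_sum_of_simps add.right_neutral)
qed

lemma coeff_pcompose_monom:
  fixes q :: "'b::comm_ring_1 poly"
  assumes "r > 0"
  shows "coeff (pcompose q (monom 1 r)) n = (if r dvd n then coeff q (n div r) else 0)"
proof (induction q arbitrary: n)
  case (pCons a q)
  show ?case
  proof (cases "n < r")
    case True
    then have "r dvd n \<longleftrightarrow> n = 0" by (auto dest: dvd_imp_le)
    then show ?thesis using True by (auto simp: pcompose_pCons coeff_monom_mult coeff_pCons split: nat.splits)
  next
    case False
    then obtain m where m: "n = m + r" by (metis add.commute le_add_diff_inverse not_less)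
    then have "coeff [:a:] n = 0" "n div r = Suc (m div r)" "r dvd n \<longleftrightarrow> r dvd m"
      using assms by (auto simp: coeff_pCons split: nat.splits)
    then show ?thesis using m by (simp add: pcompose_pCons coeff_monom_mult pCons.IH)
  qed
qed simp

lemma power_mult_not_dvd_unique:
  fixes p :: nat
  assumes "p ^ j * r = p ^ j' * r'" "\<not> p dvd r" "\<not> p dvd r'" "p > 0"
  shows "j = j' \<and> r = r'"
proof -
  have "j' \<le> j" if "p ^ j * r = p ^ j' * r'" "\<not> p dvd r" for j j' r r'
  proof (rule ccontr)
    assume "\<not> j' \<le> j"
    then obtain i where "j' = j + Suc i" by (metis less_imp_Suc_add not_le add_Suc_right)
    then have "r = p * (p ^ i * r')" using that \<open>p > 0\<close> by (simp add: power_add mult.assoc)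
    then show False using that by simp
  qed
  from this[OF assms(1,2)] this[OF assms(1)[symmetric] assms(3)] show ?thesis
    using assms by simp
qed

section \<open>Additive characters and van der Corput differencing\<close>

text \<open>Characters of F[t]/Q are kept as functions on all of F[t] that are trivial on the
  multiples of Q, so that they apply directly to unreduced values such as
  \<open>poly P y\<close>.\<close>

definition character_mod :: "'a::field poly \<Rightarrow> ('a poly \<Rightarrow> complex) \<Rightarrow> bool" where
  "character_mod Q \<chi> \<longleftrightarrow> (\<forall>x y. \<chi> (x + y) = \<chi> x * \<chi> y) \<and> (\<forall>z. \<chi> (Q * z) = 1)"

lemma character_mod_add: "character_mod Q \<chi> \<Longrightarrow> \<chi> (x + y) = \<chi> x * \<chi> y"
  and character_mod_mult: "character_mod Q \<chi> \<Longrightarrow> \<chi> (Q * z) = 1"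
  by (simp_all add: character_mod_def)

lemma character_mod_0: "character_mod Q \<chi> \<Longrightarrow> \<chi> 0 = 1"
  using character_mod_mult[of Q \<chi> 0] by simp

lemma character_mod_sum:
  "character_mod Q \<chi> \<Longrightarrow> \<chi> (\<Sum>i\<in>A. g i) = (\<Prod>i\<in>A. \<chi> (g i))"
  by (induction A rule: infinite_finite_induct) (simp_all add: character_mod_0 character_mod_add)

lemma character_mod_of_nat_mult: "character_mod Q \<chi> \<Longrightarrow> \<chi> (of_nat n * x) = \<chi> x ^ n"
  by (induction n) (simp_all add: character_mod_0 character_mod_add algebra_simps)

lemma character_mod_cong:
  assumes \<chi>: "character_mod Q \<chi>" and "Q dvd x - y"
  shows "\<chi> x = \<chi> y"
proof -
  obtain z where "x - y = Q * z" using assms(2) by (elim dvdE)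
  then have "x = y + Q * z" by (simp add: algebra_simps)
  then show ?thesis using character_mod_add[OF \<chi>] character_mod_mult[OF \<chi>] by simp
qed

lemma character_mod_mod: "character_mod Q \<chi> \<Longrightarrow> \<chi> (x mod Q) = \<chi> x"
  by (rule character_mod_cong[of Q]) (simp_all flip: mod_eq_dvd_iff)

lemma prime_CHAR_finite: "prime CHAR('a::{field,finite})"
  by (rule prime_CHAR_semidom) (simp add: finite_imp_CHAR_pos)

lemma norm_character_mod:
  fixes \<chi> :: "'a::{field,finite} poly \<Rightarrow> complex"
  assumes \<chi>: "character_mod Q \<chi>"
  shows "norm (\<chi> x) = 1"
proof -
  have "(of_nat CHAR('a) :: 'a poly) = 0" by (metis of_nat_CHAR semiring_char_poly)
  then have "\<chi> x ^ CHAR('a) = 1"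
    using character_mod_of_nat_mult[OF \<chi>, of "CHAR('a)" x] character_mod_0[OF \<chi>] by simp
  moreover have "CHAR('a) > 0" by (simp add: finite_imp_CHAR_pos)
  ultimately show ?thesis using power_eq_1_iff[of "\<chi> x" "CHAR('a)"] by simp
qed

lemma character_mod_uminus:
  fixes \<chi> :: "'a::{field,finite} poly \<Rightarrow> complex"
  assumes \<chi>: "character_mod Q \<chi>"
  shows "\<chi> (- x) = cnj (\<chi> x)"
proof -
  have "\<chi> x * \<chi> (- x) = 1"
    using character_mod_add[OF \<chi>, of x "- x"] character_mod_0[OF \<chi>] by simp
  moreover have "\<chi> x * cnj (\<chi> x) = 1"
    using norm_character_mod[OF \<chi>, of x] by (simp add: complex_norm_square[symmetric])
  ultimately show ?thesis by (metis mult_left_cancel zero_neq_one mult_zero_left)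
qed

lemma character_mod_diff:
  fixes \<chi> :: "'a::{field,finite} poly \<Rightarrow> complex"
  shows "character_mod Q \<chi> \<Longrightarrow> \<chi> (x - y) = \<chi> x * cnj (\<chi> y)"
  by (metis character_mod_add character_mod_uminus diff_conv_add_uminus)

section \<open>Residue systems and sums over them\<close>

lemma mem_residues_mod: "x \<in> residues_mod Q \<longleftrightarrow> x mod Q = x"
proof
  show "x mod Q = x \<Longrightarrow> x \<in> residues_mod Q"
    unfolding residues_mod_def by (rule range_eqI[of _ _ x]) simp
qed (auto simp: residues_mod_def)

lemma mod_in_residues_mod [simp]: "x mod Q \<in> residues_mod Q"
  by (simp add: residues_mod_def)

lemma residues_mod_eqI:
  "x \<in> residues_mod Q \<Longrightarrow> y \<in> residues_mod Q \<Longrightarrow> Q dvd x - y \<Longrightarrow> x = y"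
  by (metis mem_residues_mod mod_eq_dvd_iff)

lemma finite_card_coeff_eq_0:
  "finite {x :: 'a::{field,finite} poly. \<forall>i\<ge>n. coeff x i = 0} \<and>
   card {x :: 'a poly. \<forall>i\<ge>n. coeff x i = 0} = CARD('a) ^ n"
proof (induction n)
  case 0
  have "{x :: 'a poly. \<forall>i\<ge>0. coeff x i = 0} = {0}" by (auto simp: poly_eq_iff)
  then show ?case by simp
next
  case (Suc n)
  let ?A = "\<lambda>n. {x :: 'a poly. \<forall>i\<ge>n. coeff x i = 0}"
  have "?A (Suc n) = (\<lambda>(a, q). pCons a q) ` (UNIV \<times> ?A n)"
  proof (intro equalityI subsetI)
    fix x assume x: "x \<in> ?A (Suc n)"
    obtain a q where "x = pCons a q" by (cases x)
    moreover have "q \<in> ?A n" using x by (simp add: \<open>x = _\<close>) (metis Suc_le_mono coeff_pCons_Suc)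
    ultimately show "x \<in> (\<lambda>(a, q). pCons a q) ` (UNIV \<times> ?A n)" by auto
  qed (auto simp: coeff_pCons split: nat.splits)
  moreover have "inj_on (\<lambda>(a, q). pCons a q) (UNIV \<times> ?A n)" by (auto simp: inj_on_def)
  ultimately show ?case using Suc by (simp add: card_image card_cartesian_product)
qed

lemma
  fixes Q :: "'a::{field,finite} poly"
  assumes "Q \<noteq> 0"
  shows finite_residues_mod: "finite (residues_mod Q)"
    and card_residues_mod: "card (residues_mod Q) = poly_abs Q"
proof -
  have "residues_mod Q = {x. \<forall>i\<ge>degree Q. coeff x i = 0}"
  proof (intro equalityI subsetI)
    fix x assume "x \<in> residues_mod Q"
    then have "x = 0 \<or> degree x < degree Q"
      using degree_mod_less[OF assms, of x] by (simp add: mem_residues_mod)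
    then show "x \<in> {x. \<forall>i\<ge>degree Q. coeff x i = 0}" by (auto intro: coeff_eq_0)
  next
    fix x :: "'a poly" assume x: "x \<in> {x. \<forall>i\<ge>degree Q. coeff x i = 0}"
    have "x = 0 \<or> degree x < degree Q"
    proof (rule ccontr)
      assume "\<not> (x = 0 \<or> degree x < degree Q)"
      then have "lead_coeff x = 0" "x \<noteq> 0" using x by auto
      then show False by simp
    qed
    then show "x \<in> residues_mod Q" by (auto simp: mem_residues_mod mod_poly_less)
  qed
  then show "finite (residues_mod Q)" "card (residues_mod Q) = poly_abs Q"
    using finite_card_coeff_eq_0[where 'a = 'a, of "degree Q"] by (simp_all add: poly_abs_def)
qed

lemma poly_abs_pos: "poly_abs Q > 0"
  by (simp add: poly_abs_def)

text \<open>Adding all residues modulo \<pi> to the points of the fibre gives distinct classes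
  modulo Q.\<close>

lemma card_residues_mod_fibre_le:
  fixes Q :: "'a::{field,finite} poly"
  assumes "Q \<noteq> 0" "\<pi> dvd Q"
  shows "card {x \<in> residues_mod Q. \<pi> dvd x - v} \<le> poly_abs Q div poly_abs \<pi>"
proof -
  let ?F = "{x \<in> residues_mod Q. \<pi> dvd x - v}"
  have "\<pi> \<noteq> 0" using assms by auto
  have inj: "inj_on (\<lambda>(x, w). (x + w) mod Q) (?F \<times> residues_mod \<pi>)"
  proof (rule inj_onI, clarify)
    fix x w x' w' assume *: "x \<in> residues_mod Q" "x' \<in> residues_mod Q" "\<pi> dvd x - v" "\<pi> dvd x' - v"
      "w \<in> residues_mod \<pi>" "w' \<in> residues_mod \<pi>" "(x + w) mod Q = (x' + w') mod Q"
    then have Q: "Q dvd (x + w) - (x' + w')" by (simp add: mod_eq_dvd_iff)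
    then have "\<pi> dvd ((x + w) - (x' + w')) - (x - v) + (x' - v)"
      using * assms(2) by (meson dvd_add dvd_diff dvd_trans)
    then have "w = w'" using * by (intro residues_mod_eqI[of w \<pi>]) (simp_all add: algebra_simps)
    moreover from this have "x = x'" using Q * by (intro residues_mod_eqI[of x Q]) simp_all
    ultimately show "x = x' \<and> w = w'" by simp
  qed
  have "card (?F \<times> residues_mod \<pi>) \<le> card (residues_mod Q)"
    by (rule card_inj_on_le[OF inj]) (auto simp: finite_residues_mod[OF assms(1)])
  then have "card ?F * poly_abs \<pi> \<le> poly_abs Q"
    by (simp add: card_cartesian_product card_residues_mod assms \<open>\<pi> \<noteq> 0\<close>)
  then show ?thesis by (simp add: less_eq_div_iff_mult_less_eq poly_abs_pos)
qed

lemma sum_residues_mod_shift: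
  assumes "\<And>x. g (x mod Q) = g x"
  shows "(\<Sum>x\<in>residues_mod Q. g (x + u)) = (\<Sum>x\<in>residues_mod Q. g x)"
proof (rule sum.reindex_bij_witness[where i = "\<lambda>x. (x - u) mod Q" and j = "\<lambda>x. (x + u) mod Q"])
  fix x assume "x \<in> residues_mod Q"
  then show "((x + u) mod Q - u) mod Q = x" "((x - u) mod Q + u) mod Q = x"
    by (simp_all add: mem_residues_mod mod_diff_left_eq mod_add_left_eq)
qed (simp_all add: assms)

lemma sum_character_mod_eq_0:
  assumes \<chi>: "character_mod Q \<chi>" and u: "\<chi> u \<noteq> 1"
  shows "(\<Sum>x\<in>residues_mod Q. \<chi> x) = 0"
proof -
  have "(\<Sum>x\<in>residues_mod Q. \<chi> x) = (\<Sum>x\<in>residues_mod Q. \<chi> (x + u))"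
    by (rule sum_residues_mod_shift[symmetric]) (rule character_mod_mod[OF \<chi>])
  also have "\<dots> = (\<Sum>x\<in>residues_mod Q. \<chi> x) * \<chi> u"
    by (simp add: character_mod_add[OF \<chi>] sum_distrib_right)
  finally show ?thesis using u by (metis mult_cancel_left1 mult.commute)
qed

text \<open>Cauchy-Schwarz, applied once per doubling of the exponent.\<close>

lemma power_average_le:
  fixes g :: "'b \<Rightarrow> real"
  assumes "finite A" "A \<noteq> {}" "\<And>x. x \<in> A \<Longrightarrow> g x \<ge> 0"
  shows "((\<Sum>x\<in>A. g x) / card A) ^ (2 ^ m) \<le> (\<Sum>x\<in>A. g x ^ (2 ^ m)) / card A"
proof (induction m)
  case (Suc m)
  have c: "real (card A) > 0" using assms by (simp add: card_gt_0_iff)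
  have e: "(g x ^ (2 ^ m)) ^ 2 = g x ^ (2 ^ Suc m)" for x
    by (simp add: mult.commute flip: power_mult)
  have "((\<Sum>x\<in>A. g x) / card A) ^ (2 ^ Suc m) = (((\<Sum>x\<in>A. g x) / card A) ^ (2 ^ m)) ^ 2"
    by (simp add: mult.commute flip: power_mult)
  also have "\<dots> \<le> ((\<Sum>x\<in>A. g x ^ (2 ^ m)) / card A) ^ 2"
    using assms by (intro power_mono[OF Suc] zero_le_power divide_nonneg_nonneg sum_nonneg) auto
  also have "\<dots> \<le> (real (card A) * (\<Sum>x\<in>A. (g x ^ (2 ^ m)) ^ 2)) / card A ^ 2"
    using sum_squared_le_sum_of_squares[of "\<lambda>x. g x ^ (2 ^ m)" A]
    by (simp add: power_divide divide_right_mono mult.commute)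
  also have "\<dots> = (\<Sum>x\<in>A. g x ^ (2 ^ Suc m)) / card A"
    unfolding e using c by (simp add: power2_eq_square)
  finally show ?case .
qed simp

lemma sum_lists_length_Suc:
  assumes "finite A"
  shows "(\<Sum>us\<in>{us. set us \<subseteq> A \<and> length us = Suc m}. g us)
    = (\<Sum>u\<in>A. \<Sum>us\<in>{us. set us \<subseteq> A \<and> length us = m}. g (u # us))"
proof -
  have "(\<Sum>u\<in>A. \<Sum>us\<in>{us. set us \<subseteq> A \<and> length us = m}. g (u # us))
      = (\<Sum>(us, u)\<in>{us. set us \<subseteq> A \<and> length us = m} \<times> A. g (u # us))"
    by (subst sum.swap) (simp add: sum.cartesian_product)
  also have "\<dots> = (\<Sum>us\<in>(\<lambda>(us, u). u # us) ` ({us. set us \<subseteq> A \<and> length us = m} \<times> A). g us)"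
    by (subst sum.reindex) (auto simp: inj_on_def case_prod_beta)
  finally show ?thesis by (simp add: lists_length_Suc_eq)
qed

text \<open>Substituting z = y + u in the double sum shows that the squared modulus of an average is
  the mean over u of the averages of \<chi> along the difference in direction u. Dropping the phases
  and using convexity of x^(2^m) allows iteration.\<close>

lemma van_der_Corput:
  fixes \<chi> :: "'a::{field,finite} poly \<Rightarrow> complex"
  assumes Q: "Q \<noteq> 0" and \<chi>: "character_mod Q \<chi>"
  shows "(\<And>x y. Q dvd x - y \<Longrightarrow> Q dvd g x - g y) \<Longrightarrow>
    cmod (average (residues_mod Q) (\<lambda>y. \<chi> (g y))) ^ (2 ^ m)
    \<le> (\<Sum>us\<in>{us. set us \<subseteq> residues_mod Q \<and> length us = m}.
        cmod (average (residues_mod Q) (\<lambda>y. \<chi> (fold difference us g y)))) / real (card (residues_mod Q)) ^ m"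
proof (induction m arbitrary: g)
  case 0
  have "{us. set us \<subseteq> residues_mod Q \<and> length us = 0} = {[]}" by auto
  then show ?case by simp
next
  case (Suc m)
  let ?R = "residues_mod Q"
  let ?n = "real (card ?R)"
  let ?L = "{us. set us \<subseteq> ?R \<and> length us = m}"
  let ?E = "\<lambda>g. average ?R (\<lambda>y. \<chi> (g y))"
  note fin = finite_residues_mod[OF Q]
  have ne: "?R \<noteq> {}" by (auto simp: residues_mod_def)
  then have n: "?n > 0" using fin by (simp add: card_gt_0_iff)
  have per: "\<chi> (g (x mod Q)) = \<chi> (g x)" for x
    by (intro character_mod_cong[OF \<chi>] Suc.prems) (simp add: flip: mod_eq_dvd_iff)
  have D: "Q dvd difference u g x - difference u g y" if "Q dvd x - y" for u x y
  proof -
    have "Q dvd (g (x + u) - g (y + u)) - (g x - g y)"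
      by (rule dvd_diff) (rule Suc.prems, simp add: that)+
    then show ?thesis by (simp add: difference_def algebra_simps)
  qed
  have "(\<Sum>y\<in>?R. \<chi> (g y)) * cnj (\<Sum>y\<in>?R. \<chi> (g y)) = (\<Sum>y\<in>?R. (\<Sum>z\<in>?R. \<chi> (g z)) * cnj (\<chi> (g y)))"
    by (simp add: sum_distrib_left)
  also have "\<dots> = (\<Sum>y\<in>?R. (\<Sum>u\<in>?R. \<chi> (g (u + y))) * cnj (\<chi> (g y)))"
    by (simp add: sum_residues_mod_shift[of "\<lambda>x. \<chi> (g x)"] per)
  also have "\<dots> = (\<Sum>u\<in>?R. \<Sum>y\<in>?R. \<chi> (difference u g y))"
    unfolding sum_distrib_right
    by (subst sum.swap) (simp add: difference_def character_mod_diff[OF \<chi>] add.commute)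
  finally have sq: "(\<Sum>y\<in>?R. \<chi> (g y)) * cnj (\<Sum>y\<in>?R. \<chi> (g y)) = \<dots>" .
  have "cmod (?E g) ^ 2 = cmod ((\<Sum>y\<in>?R. \<chi> (g y)) * cnj (\<Sum>y\<in>?R. \<chi> (g y))) / ?n ^ 2"
    by (simp only: average_def norm_divide norm_mult complex_mod_cnj norm_of_nat power2_eq_square
        times_divide_times_eq)
  also have "\<dots> \<le> (\<Sum>u\<in>?R. cmod (\<Sum>y\<in>?R. \<chi> (difference u g y))) / ?n ^ 2"
    unfolding sq by (intro divide_right_mono norm_sum) simp
  also have "\<dots> = (\<Sum>u\<in>?R. cmod (?E (difference u g))) / ?n"
    using n by (simp add: average_def norm_divide power2_eq_square flip: sum_divide_distrib)
  finally have step: "cmod (?E g) ^ 2 \<le> (\<Sum>u\<in>?R. cmod (?E (difference u g))) / ?n" .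
  have "cmod (?E g) ^ (2 ^ Suc m) = (cmod (?E g) ^ 2) ^ (2 ^ m)"
    by (simp flip: power_mult)
  also have "\<dots> \<le> ((\<Sum>u\<in>?R. cmod (?E (difference u g))) / ?n) ^ (2 ^ m)"
    using step by (rule power_mono) simp
  also have "\<dots> \<le> (\<Sum>u\<in>?R. cmod (?E (difference u g)) ^ (2 ^ m)) / ?n"
    by (rule power_average_le[OF fin ne]) simp
  also have "\<dots> \<le> (\<Sum>u\<in>?R. (\<Sum>us\<in>?L. cmod (?E (fold difference us (difference u g)))) / ?n ^ m) / ?n"
    by (intro divide_right_mono sum_mono Suc.IH D) simp_all
  also have "\<dots> = (\<Sum>us\<in>{us. set us \<subseteq> ?R \<and> length us = Suc m}. cmod (?E (fold difference us g))) / ?n ^ Suc m"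
    unfolding sum_lists_length_Suc[OF fin] by (simp add: sum_divide_distrib mult.commute)
  finally show ?case .
qed

section \<open>Fourier expansion and duality\<close>

definition character_span :: "'a::field poly \<Rightarrow> ('a poly \<Rightarrow> complex) set" where
  "character_span Q = {f. \<exists>X c. finite X \<and> (\<forall>\<chi>\<in>X. character_mod Q \<chi>) \<and> f = (\<lambda>x. \<Sum>\<chi>\<in>X. c \<chi> * \<chi> x)}"

lemma character_span_0: "(\<lambda>x. 0) \<in> character_span Q"
  unfolding character_span_def by (auto intro!: exI[of _ "{}"])

lemma character_span_add:
  assumes "f \<in> character_span Q" "g \<in> character_span Q"
  shows "(\<lambda>x. f x + g x) \<in> character_span Q"
proof -
  obtain X c Y d where *: "finite X" "\<forall>\<chi>\<in>X. character_mod Q \<chi>" "f = (\<lambda>x. \<Sum>\<chi>\<in>X. c \<chi> * \<chi> x)"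
    "finite Y" "\<forall>\<chi>\<in>Y. character_mod Q \<chi>" "g = (\<lambda>x. \<Sum>\<chi>\<in>Y. d \<chi> * \<chi> x)"
    using assms unfolding character_span_def by blast
  let ?c = "\<lambda>\<chi>. (if \<chi> \<in> X then c \<chi> else 0) + (if \<chi> \<in> Y then d \<chi> else 0)"
  have "f x + g x = (\<Sum>\<chi>\<in>X \<union> Y. ?c \<chi> * \<chi> x)" for x
  proof -
    have "f x = (\<Sum>\<chi>\<in>X \<union> Y. (if \<chi> \<in> X then c \<chi> else 0) * \<chi> x)"
      "g x = (\<Sum>\<chi>\<in>X \<union> Y. (if \<chi> \<in> Y then d \<chi> else 0) * \<chi> x)"
      using * by (auto intro!: sum.mono_neutral_cong_left)
    then show ?thesis by (simp add: sum.distrib distrib_right)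
  qed
  then show ?thesis unfolding character_span_def using * by (auto intro!: exI[of _ "X \<union> Y"] exI[of _ ?c])
qed

lemma character_span_sum:
  "(\<And>i. i \<in> A \<Longrightarrow> f i \<in> character_span Q) \<Longrightarrow> (\<lambda>x. \<Sum>i\<in>A. f i x) \<in> character_span Q"
  by (induction A rule: infinite_finite_induct) (simp_all add: character_span_0 character_span_add)

lemma sum_roots_of_unity:
  assumes "i < n"
  shows "(\<Sum>j<n. inverse (cis (2 * pi * real j / real n)) ^ i) = (if i = 0 then of_nat n else 0)"
proof (cases "i = 0")
  case False
  define z where "z = inverse (cis (2 * pi * i / n))"
  have n: "real n > 0" using assms by simp
  have "inj_on (\<lambda>k. cis (2 * pi * real k / real n)) {..<n}"
    using bij_betw_roots_unity[of n] n by (simp add: bij_betw_def)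
  then have "cis (2 * pi * i / n) \<noteq> cis (2 * pi * (0::nat) / n)"
    using assms False unfolding inj_on_def by (metis lessThan_iff less_nat_zero_code not_gr_zero)
  then have "z \<noteq> 1" by (simp add: z_def del: cis_inverse)
  have "z ^ n = 1"
    using n by (simp add: z_def power_inverse DeMoivre cis_multiple_2pi del: cis_inverse)
  have "(\<Sum>j<n. inverse (cis (2 * pi * real j / real n)) ^ i) = (\<Sum>j<n. z ^ j)"
    by (intro sum.cong refl) (simp add: z_def power_inverse DeMoivre mult_ac)
  also have "\<dots> = 0"
    using \<open>z \<noteq> 1\<close> \<open>z ^ n = 1\<close> by (simp add: geometric_sum)
  finally show ?thesis using False by simp
qed simp

text \<open>
  Averaging over the translates by multiples of \<open>v\<close> projects onto the eigenspaces of the translation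
  by \<open>v\<close>; a common eigenfunction of all translations is a multiple of a character.
\<close>

lemma periodic_in_character_span:
  fixes f :: "'a::{field,finite} poly \<Rightarrow> complex"
  assumes Q: "Q \<noteq> 0"
  shows "(\<And>x z. f (x + Q * z) = f x) \<Longrightarrow> f \<in> character_span Q"
proof -
  let ?p = "CHAR('a)"
  let ?R = "residues_mod Q"
  have p: "?p > 0" by (simp add: finite_imp_CHAR_pos)
  \<comment> \<open>\<open>V\<close> collects the residues whose translation is not yet known to act
    on f by a scalar. Each induction step splits f into eigenfunctions of one more translation; for
    \<open>V\<close> the set of all residues the last hypothesis is vacuous.\<close>
  have eigen: "f \<in> character_span Q"
    if "finite V" "\<And>x z. f (x + Q * z) = f x" "\<And>w. w \<in> ?R - V \<Longrightarrow> \<exists>\<zeta>. \<forall>x. f (x + w) = \<zeta> * f x"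
    for V f using that
  proof (induction V arbitrary: f rule: finite_induct)
    case empty
    have ev: "\<exists>\<zeta>. \<forall>x. f (x + w) = \<zeta> * f x" for w
    proof -
      have "f (x + w) = f (x + w mod Q)" for x
        using empty(1)[of "x + w mod Q" "w div Q"] by (simp add: algebra_simps flip: mult.commute[of Q])
      then show ?thesis using empty(2)[of "w mod Q"] by simp
    qed
    show ?case
    proof (cases "f 0 = 0")
      case True
      have "f w = 0" for w using ev[of w] True by (metis add_0 mult_zero_right)
      then have "f = (\<lambda>x. 0)" by auto
      then show ?thesis by (simp add: character_span_0)
    next
      case False
      define \<chi> where "\<chi> = (\<lambda>x. f x / f 0)"
      have "\<chi> (x + y) = \<chi> x * \<chi> y" for x y
      proof -
        obtain \<zeta> where \<zeta>: "\<And>x. f (x + y) = \<zeta> * f x" using ev by blast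
        then show ?thesis using \<zeta>[of 0] False by (simp add: \<chi>_def)
      qed
      moreover have "\<chi> (Q * z) = 1" for z using empty(1)[of 0 z] False by (simp add: \<chi>_def)
      ultimately have "character_mod Q \<chi>" by (simp add: character_mod_def)
      moreover have "f = (\<lambda>x. \<Sum>\<chi>\<in>{\<chi>}. f 0 * \<chi> x)" using False by (auto simp: \<chi>_def)
      ultimately show ?thesis unfolding character_span_def
        by (auto intro!: exI[of _ "{\<chi>}"] exI[of _ "\<lambda>_. f 0"])
    qed
  next
    case (insert v V)
    define \<zeta> where "\<zeta> j = cis (2 * pi * real j / real ?p)" for j :: nat
    have \<zeta>: "\<zeta> j ^ ?p = 1" for j
      using p by (simp add: \<zeta>_def DeMoivre cis_multiple_2pi)
    have roots: "(\<Sum>j<?p. inverse (\<zeta> j) ^ i) = (if i = 0 then of_nat ?p else 0)" if "i < ?p" for i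
      using sum_roots_of_unity[OF that] by (simp only: \<zeta>_def)
    \<comment> \<open>The component of f in the eigenspace for \<zeta>_j of the translation by v.
      Since p v = 0, the p-th roots of unity exhaust the eigenvalues and the components add up to
      f.\<close>
    define g where "g j = (\<lambda>x. (\<Sum>i<?p. inverse (\<zeta> j) ^ i * f (x + of_nat i * v)) / of_nat ?p)" for j
    have "f x = (\<Sum>j<?p. g j x)" for x
    proof -
      have "(\<Sum>j<?p. g j x) = (\<Sum>j<?p. \<Sum>i<?p. inverse (\<zeta> j) ^ i * f (x + of_nat i * v)) / of_nat ?p"
        by (simp add: g_def sum_divide_distrib)
      also have "\<dots> = (\<Sum>i<?p. (\<Sum>j<?p. inverse (\<zeta> j) ^ i) * f (x + of_nat i * v)) / of_nat ?p"
        by (subst sum.swap) (simp add: sum_distrib_right)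
      also have "\<dots> = (\<Sum>i<?p. if i = 0 then of_nat ?p * f x else 0) / of_nat ?p"
        by (intro arg_cong2[of _ _ _ _ "(/)"] sum.cong refl) (simp_all add: roots)
      also have "\<dots> = f x" using p by (simp add: sum.delta)
      finally show ?thesis by simp
    qed
    then have f: "f = (\<lambda>x. \<Sum>j<?p. g j x)" by auto
    have "g j \<in> character_span Q" for j
    proof (rule insert.IH)
      show "g j (x + Q * z) = g j x" for x z
      proof -
        have "x + Q * z + of_nat i * v = (x + of_nat i * v) + Q * z" for i :: nat
          by (simp add: algebra_simps)
        then show ?thesis by (simp only: g_def insert.prems(1))
      qed
    next
      fix w assume w: "w \<in> ?R - V"
      show "\<exists>\<xi>. \<forall>x. g j (x + w) = \<xi> * g j x"
      proof (cases "w = v")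
        case True
        have char0: "(of_nat ?p :: 'a poly) = 0" by (metis of_nat_CHAR semiring_char_poly)
        have "g j (x + v) = \<zeta> j * g j x" for x
        proof -
          let ?h = "\<lambda>i. inverse (\<zeta> j) ^ i * f (x + of_nat i * v)"
          have nz: "\<zeta> j \<noteq> 0" by (simp add: \<zeta>_def)
          \<comment> \<open>The index shift wraps around: the terms for i = 0 and i = p agree
            because p v = 0 and \<zeta>_j is a p-th root of unity.\<close>
          have "(\<Sum>i<?p. ?h (Suc i)) + ?h 0 = (\<Sum>i<Suc ?p. ?h i)"
            by (simp only: sum.lessThan_Suc_shift add.commute)
          also have "\<dots> = (\<Sum>i<?p. ?h i) + ?h 0"
            using \<zeta>[of j] by (simp add: char0 power_inverse)
          finally have "(\<Sum>i<?p. ?h (Suc i)) = (\<Sum>i<?p. ?h i)" by simp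
          then have "\<zeta> j * (\<Sum>i<?p. ?h (Suc i)) = \<zeta> j * (\<Sum>i<?p. ?h i)" by simp
          moreover have "\<zeta> j * ?h (Suc i) = inverse (\<zeta> j) ^ i * f (x + v + of_nat i * v)" for i
          proof -
            have "x + v + of_nat i * v = x + of_nat (Suc i) * v" by (simp add: algebra_simps)
            then show ?thesis
              by (simp only: power_Suc mult.assoc[symmetric] right_inverse[OF nz] mult_1_left)
          qed
          ultimately have "(\<Sum>i<?p. inverse (\<zeta> j) ^ i * f (x + v + of_nat i * v)) = \<zeta> j * (\<Sum>i<?p. ?h i)"
            by (simp only: sum_distrib_left)
          then show ?thesis by (simp add: g_def)
        qed
        then show ?thesis using True by blast
      next
        case False
        then obtain \<xi> where \<xi>: "\<And>x. f (x + w) = \<xi> * f x" using insert.prems(2)[of w] w by auto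
        \<comment> \<open>Translations commute, so projecting with respect to v keeps the eigenvalue
          for w.\<close>
        have "x + w + of_nat i * v = (x + of_nat i * v) + w" for x and i :: nat
          by (simp add: algebra_simps)
        then have "g j (x + w) = \<xi> * g j x" for x
          by (simp only: g_def \<xi>) (simp add: sum_distrib_left mult_ac)
        then show ?thesis by blast
      qed
    qed
    then show ?case by (subst f) (rule character_span_sum)
  qed
  show "(\<And>x z. f (x + Q * z) = f x) \<Longrightarrow> f \<in> character_span Q"
    by (rule eigen[of ?R]) (simp_all add: finite_residues_mod[OF Q])
qed

section \<open>Orthogonality and Parseval\<close>

lemma sum_character_mod_mult_cnj:
  fixes \<chi> \<chi>' :: "'a::{field,finite} poly \<Rightarrow> complex"
  assumes \<chi>: "character_mod Q \<chi>" and \<chi>': "character_mod Q \<chi>'"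
  shows "(\<Sum>x\<in>residues_mod Q. \<chi> x * cnj (\<chi>' x)) = (if \<chi> = \<chi>' then of_nat (card (residues_mod Q)) else 0)"
proof (cases "\<chi> = \<chi>'")
  case True
  then have "\<chi> x * cnj (\<chi>' x) = 1" for x
    using norm_character_mod[OF \<chi>, of x] by (simp add: complex_norm_square[symmetric])
  then show ?thesis using True by simp
next
  case False
  then obtain u where u: "\<chi> u \<noteq> \<chi>' u" by auto
  have "\<chi>' u * cnj (\<chi>' u) = 1"
    using norm_character_mod[OF \<chi>', of u] by (simp add: complex_norm_square[symmetric])
  then have "\<chi> u * cnj (\<chi>' u) \<noteq> 1" using u by (metis mult_cancel_right mult_zero_right zero_neq_one)
  moreover have "character_mod Q (\<lambda>x. \<chi> x * cnj (\<chi>' x))"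
    using assms by (simp add: character_mod_def)
  ultimately show ?thesis using sum_character_mod_eq_0 False by auto
qed

lemma parseval:
  fixes X :: "('a::{field,finite} poly \<Rightarrow> complex) set"
  assumes Q: "Q \<noteq> 0" and X: "finite X" "\<And>\<chi>. \<chi> \<in> X \<Longrightarrow> character_mod Q \<chi>"
  shows "average (residues_mod Q) (\<lambda>x. (cmod (\<Sum>\<chi>\<in>X. c \<chi> * \<chi> x))\<^sup>2) = (\<Sum>\<chi>\<in>X. (cmod (c \<chi>))\<^sup>2)"
proof -
  let ?R = "residues_mod Q"
  have n: "card ?R > 0" by (simp add: card_residues_mod[OF Q] poly_abs_pos)
  have "complex_of_real (\<Sum>x\<in>?R. (cmod (\<Sum>\<chi>\<in>X. c \<chi> * \<chi> x))\<^sup>2)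
      = (\<Sum>x\<in>?R. (\<Sum>\<chi>\<in>X. c \<chi> * \<chi> x) * cnj (\<Sum>\<chi>\<in>X. c \<chi> * \<chi> x))"
    by (simp only: of_real_sum complex_norm_square)
  also have "\<dots> = (\<Sum>x\<in>?R. \<Sum>\<chi>\<in>X. \<Sum>\<chi>'\<in>X. c \<chi> * cnj (c \<chi>') * (\<chi> x * cnj (\<chi>' x)))"
    by (simp add: sum_product mult_ac)
  also have "\<dots> = (\<Sum>\<chi>\<in>X. \<Sum>\<chi>'\<in>X. c \<chi> * cnj (c \<chi>') * (\<Sum>x\<in>?R. \<chi> x * cnj (\<chi>' x)))"
    by (subst sum.swap, rule sum.cong[OF refl], subst sum.swap) (simp add: sum_distrib_left)
  also have "\<dots> = (\<Sum>\<chi>\<in>X. \<Sum>\<chi>'\<in>X. if \<chi> = \<chi>' then c \<chi> * cnj (c \<chi>') * of_nat (card ?R) else 0)"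
    by (intro sum.cong refl) (simp add: sum_character_mod_mult_cnj X)
  also have "\<dots> = complex_of_real ((\<Sum>\<chi>\<in>X. (cmod (c \<chi>))\<^sup>2) * card ?R)"
    using X(1) by (simp add: sum.delta complex_norm_square sum_distrib_right flip: of_real_power)
  finally show ?thesis using n by (simp only: of_real_eq_iff) (simp add: average_def)
qed

section \<open>Inverses, Frobenius roots and duality modulo a prime\<close>

lemma mult_inverse_mod:
  fixes \<pi> :: "'a::{field,finite} poly"
  assumes \<pi>: "prime_elem \<pi>" and x: "\<not> \<pi> dvd x"
  shows "\<exists>b. \<pi> dvd b * x - y"
proof -
  let ?R = "residues_mod \<pi>"
  have "\<pi> \<noteq> 0" using \<pi> by auto
  have "inj_on (\<lambda>b. (b * x) mod \<pi>) ?R"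
  proof (rule inj_onI)
    fix b b' assume b: "b \<in> ?R" "b' \<in> ?R" "(b * x) mod \<pi> = (b' * x) mod \<pi>"
    then have "\<pi> dvd (b - b') * x" by (simp add: mod_eq_dvd_iff algebra_simps)
    then have "\<pi> dvd b - b'" using \<pi> x by (simp add: prime_elem_dvd_mult_iff)
    then show "b = b'" using b by (intro residues_mod_eqI)
  qed
  moreover have "(\<lambda>b. (b * x) mod \<pi>) ` ?R \<subseteq> ?R" by auto
  ultimately have "(\<lambda>b. (b * x) mod \<pi>) ` ?R = ?R"
    using endo_inj_surj[OF finite_residues_mod[OF \<open>\<pi> \<noteq> 0\<close>]] by blast
  then have "y mod \<pi> \<in> (\<lambda>b. (b * x) mod \<pi>) ` ?R" by simp
  then obtain b where "y mod \<pi> = (b * x) mod \<pi>" by blast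
  then have "\<pi> dvd b * x - y" by (metis mod_eq_dvd_iff)
  then show ?thesis by blast
qed

text \<open>Finite fields are perfect: the p^l-th power map is additive with trivial kernel modulo
  \<pi>, hence injective and so surjective on residues.\<close>

lemma power_CHAR_power_root_mod:
  fixes \<pi> :: "'a::{field,finite} poly"
  assumes \<pi>: "prime_elem \<pi>"
  shows "\<exists>b. \<pi> dvd b ^ (CHAR('a) ^ l) - y"
proof -
  let ?R = "residues_mod \<pi>"
  let ?q = "CHAR('a) ^ l"
  have "\<pi> \<noteq> 0" using \<pi> by auto
  have char: "prime CHAR('a poly)" by (simp add: prime_CHAR_finite)
  have "inj_on (\<lambda>b. (b ^ ?q) mod \<pi>) ?R"
  proof (rule inj_onI)
    fix b b' assume b: "b \<in> ?R" "b' \<in> ?R" "(b ^ ?q) mod \<pi> = (b' ^ ?q) mod \<pi>"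
    have "b ^ ?q = (b - b') ^ ?q + b' ^ ?q"
      using power_CHAR_power_add[OF char, of "b - b'" b' l] by simp
    then have "\<pi> dvd (b - b') ^ ?q" using b(3) by (simp add: mod_eq_dvd_iff)
    then have "\<pi> dvd b - b'" using \<pi> prime_elem_dvd_power by blast
    then show "b = b'" using b by (intro residues_mod_eqI)
  qed
  moreover have "(\<lambda>b. (b ^ ?q) mod \<pi>) ` ?R \<subseteq> ?R" by auto
  ultimately have "(\<lambda>b. (b ^ ?q) mod \<pi>) ` ?R = ?R"
    using endo_inj_surj[OF finite_residues_mod[OF \<open>\<pi> \<noteq> 0\<close>]] by blast
  then have "y mod \<pi> \<in> (\<lambda>b. (b ^ ?q) mod \<pi>) ` ?R" by simp
  then obtain b where "y mod \<pi> = (b ^ ?q) mod \<pi>" by blast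
  then have "\<pi> dvd b ^ ?q - y" by (metis mod_eq_dvd_iff)
  then show ?thesis by blast
qed

text \<open>
  If \<open>\<phi>\<close> were orthogonal to all characters \<open>x \<mapsto> \<Phi> (b * x)\<close>, then summing over \<open>b\<close> would
  give \<open>\<phi> 0 = 0\<close>.
\<close>

lemma character_mod_prime_self_dual:
  fixes \<pi> :: "'a::{field,finite} poly"
  assumes \<pi>: "prime_elem \<pi>" and \<Phi>: "character_mod \<pi> \<Phi>" "\<Phi> y \<noteq> 1" and \<phi>: "character_mod \<pi> \<phi>"
  shows "\<exists>b. \<forall>w. \<phi> w = \<Phi> (b * w)"
proof (rule ccontr)
  assume no: "\<not> ?thesis"
  let ?R = "residues_mod \<pi>"
  have nz: "\<pi> \<noteq> 0" using \<pi> by auto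
  have ch: "character_mod \<pi> (\<lambda>w. \<Phi> (b * w))" for b
    using \<Phi>(1) by (simp add: character_mod_def distrib_left mult.left_commute[of b])
  have "(\<Sum>x\<in>?R. \<phi> x * cnj (\<Phi> (b * x))) = 0" for b
    using sum_character_mod_mult_cnj[OF \<phi> ch[of b]] no by auto
  then have "0 = (\<Sum>b\<in>?R. \<Sum>x\<in>?R. \<phi> x * cnj (\<Phi> (b * x)))" by simp
  also have "\<dots> = (\<Sum>x\<in>?R. \<phi> x * (\<Sum>b\<in>?R. cnj (\<Phi> (b * x))))"
    by (subst sum.swap) (simp add: sum_distrib_left)
  also have "\<dots> = (\<Sum>x\<in>?R. if x = 0 then of_nat (card ?R) else 0)"
  proof (rule sum.cong[OF refl])
    fix x assume x: "x \<in> ?R"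
    show "\<phi> x * (\<Sum>b\<in>?R. cnj (\<Phi> (b * x))) = (if x = 0 then of_nat (card ?R) else 0)"
    proof (cases "x = 0")
      case False
      then have "\<not> \<pi> dvd x" using x by (auto simp: mem_residues_mod dvd_eq_mod_eq_0)
      \<comment> \<open>For x nonzero modulo \<pi>, the character b \<mapsto> \<Phi> (x * b) is
        nontrivial: it takes the value \<Phi> y \<noteq> 1. So its sum is 0 and only x = 0
        survives.\<close>
      then obtain b where "\<pi> dvd b * x - y" using mult_inverse_mod[OF \<pi>] by blast
      then have "\<Phi> (x * b) \<noteq> 1" using character_mod_cong[OF \<Phi>(1)] \<Phi>(2) by (metis mult.commute)
      then have "(\<Sum>b\<in>?R. \<Phi> (x * b)) = 0" by (rule sum_character_mod_eq_0[OF ch])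
      then have "cnj (\<Sum>b\<in>?R. \<Phi> (x * b)) = 0" by simp
      then show ?thesis using False by (simp add: mult.commute)
    qed (simp add: character_mod_0[OF \<phi>] character_mod_0[OF \<Phi>(1)])
  qed
  also have "\<dots> = of_nat (card ?R)"
    using finite_residues_mod[OF nz] by (simp add: sum.delta mem_residues_mod)
  finally show False using poly_abs_pos[of \<pi>] by (simp add: card_residues_mod[OF nz])
qed

section \<open>Degenerate directions\<close>

text \<open>A monic divisor of least positive degree cannot split.\<close>

lemma monic_irreducible_factor_exists:
  fixes D :: "'a::field poly"
  assumes "degree D > 0"
  shows "\<exists>\<pi>. irreducible \<pi> \<and> lead_coeff \<pi> = 1 \<and> \<pi> dvd D"
proof -
  let ?P = "\<lambda>\<pi>. lead_coeff \<pi> = 1 \<and> \<pi> dvd D \<and> degree \<pi> > 0"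
  have monic: "?P (smult (inverse (lead_coeff a)) a)" if "a dvd D" "degree a > 0" for a
  proof -
    have "a \<noteq> 0" using that by auto
    then show ?thesis using that by (auto simp: smult_dvd_iff)
  qed
  obtain \<pi> where \<pi>: "?P \<pi>" and min: "\<And>a. ?P a \<Longrightarrow> degree \<pi> \<le> degree a"
    using monic[OF dvd_refl assms] ex_has_least_nat[of ?P _ degree] by blast
  have "irreducible \<pi>"
  proof (rule irreducibleI)
    show "\<pi> \<noteq> 0" using \<pi> by auto
    then show "\<not> \<pi> dvd 1" using \<pi> by (simp add: is_unit_iff_degree)
    fix a b assume ab: "\<pi> = a * b"
    then have nz: "a \<noteq> 0" "b \<noteq> 0" using \<open>\<pi> \<noteq> 0\<close> by auto
    have deg: "degree \<pi> = degree a + degree b" using nz by (simp add: ab degree_mult_eq)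
    show "a dvd 1 \<or> b dvd 1"
    proof (cases "degree a = 0")
      case False
      have "a dvd D" using \<pi> ab by (metis dvd_mult_left)
      then have "degree \<pi> \<le> degree a"
        using min[OF monic[of a]] False nz by simp
      then show ?thesis using deg nz by (simp add: is_unit_iff_degree)
    qed (use nz in \<open>simp add: is_unit_iff_degree\<close>)
  qed
  then show ?thesis using \<pi> by blast
qed

lemma prime_elem_not_dvd_of_nat:
  fixes \<pi> :: "'a::{field,finite} poly"
  assumes "prime_elem \<pi>" "\<not> CHAR('a) dvd n"
  shows "\<not> \<pi> dvd of_nat n"
proof
  assume "\<pi> dvd of_nat n"
  moreover have "(of_nat n :: 'a) \<noteq> 0" using assms(2) by (simp add: of_nat_eq_0_iff_char_dvd)
  then have "(of_nat n :: 'a poly) dvd 1" by (simp add: of_nat_poly is_unit_pCons_iff)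
  ultimately have "\<pi> dvd 1" by (rule dvd_trans)
  then show False using assms(1) by (simp add: prime_elem_def)
qed

lemma dvd_diff_power:
  fixes x y :: "'b::comm_ring_1"
  shows "\<pi> dvd x - y \<Longrightarrow> \<pi> dvd x ^ n - y ^ n"
  by (metis dvd_trans power_diff_sumr2 dvd_triv_left)

text \<open>
  With \<open>D\<close> a divisor of \<open>Q\<close> of least degree modulo which all \<open>\<psi> i\<close> are defined, and
  \<open>\<pi>\<close> an irreducible factor of \<open>D\<close>, only the values of the \<open>\<psi> i\<close> on multiples of
  \<open>c = D / \<pi>\<close> are used. There they become characters \<open>w \<mapsto> \<Phi> (b i * w)\<close> of the field
  \<open>F[t]/\<pi>\<close>, where the Frobenius map has an adjoint \<open>\<Phi> (x ^ p ^ l) = \<Phi> (\<beta> l * x)\<close>. Hence the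
  condition on \<open>us\<close> becomes a polynomial equation modulo \<open>\<pi>\<close>; no two of its monomials coincide,
  since the total degrees determine the numbers \<open>p ^ (L - l) * power_sum_of p (e i)\<close>.
\<close>

lemma card_polarization_trivial_le:
  fixes Q :: "'a::{field,finite} poly" and \<psi> :: "'i \<Rightarrow> 'a poly \<Rightarrow> complex" and e :: "'i \<Rightarrow> nat multiset"
  defines "p \<equiv> CHAR('a)"
  assumes Q: "Q \<noteq> 0" and I: "finite I" and \<psi>: "\<And>i. i \<in> I \<Longrightarrow> character_mod Q (\<psi> i)"
    and i0: "i0 \<in> I" "\<psi> i0 y0 \<noteq> 1"
    and size_e: "\<And>i. i \<in> I \<Longrightarrow> size (e i) = Suc m"
    and count_e: "\<And>i l. i \<in> I \<Longrightarrow> count (e i) l < p"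
    and e_le: "\<And>i l. i \<in> I \<Longrightarrow> l \<in># e i \<Longrightarrow> l \<le> L"
    and e_dvd: "\<And>i. i \<in> I \<Longrightarrow> \<not> p dvd power_sum_of p (e i)"
    and e_inj: "inj_on (\<lambda>i. power_sum_of p (e i)) I"
  shows "\<exists>\<pi>. irreducible \<pi> \<and> lead_coeff \<pi> = 1 \<and> \<pi> dvd Q \<and>
    card {us. set us \<subseteq> residues_mod Q \<and> length us = m \<and>
        (\<forall>y. (\<Prod>i\<in>I. \<psi> i (polarization p (e i) (y # us))) = 1)} * poly_abs \<pi>
      \<le> m * p ^ (2 * L) * card (residues_mod Q) ^ m"
proof -
  let ?R = "residues_mod Q"
  have char: "prime p" and charp: "prime CHAR('a poly)" and pCHAR: "p = CHAR('a poly)"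
    by (simp_all add: p_def prime_CHAR_finite)
  have p0: "p > 0" and p1: "p > 1" using prime_gt_1_nat[OF char] by simp_all
  let ?P = "\<lambda>D. D dvd Q \<and> (\<forall>i\<in>I. \<forall>z. \<psi> i (D * z) = 1)"
  have "?P Q" using \<psi> by (auto simp: character_mod_mult)
  then obtain D where D: "?P D" and min: "\<And>c. ?P c \<Longrightarrow> degree D \<le> degree c"
    using ex_has_least_nat[of ?P Q degree] by blast
  have "D \<noteq> 0" using D Q by auto
  have "degree D > 0"
  proof (rule ccontr)
    assume "\<not> degree D > 0"
    then have "D dvd y0" using \<open>D \<noteq> 0\<close> by (meson gr0I is_unit_iff_degree unit_imp_dvd)
    then show False using D i0 by auto
  qed
  then obtain \<pi> where \<pi>: "irreducible \<pi>" "lead_coeff \<pi> = 1" "\<pi> dvd D"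
    using monic_irreducible_factor_exists by blast
  have \<pi>Q: "\<pi> dvd Q" using \<pi>(3) D dvd_trans by blast
  have pe: "prime_elem \<pi>" using \<pi>(1) by (rule field_poly_irreducible_imp_prime)
  have "\<pi> \<noteq> 0" "\<not> \<pi> dvd 1" using pe by (auto simp: prime_elem_def)
  then have "degree \<pi> > 0" by (auto simp: is_unit_iff_degree)
  obtain c where c: "D = \<pi> * c" using \<pi>(3) by (elim dvdE)
  have "c \<noteq> 0" using c \<open>D \<noteq> 0\<close> by auto
  then have "degree c < degree D"
    using c \<open>\<pi> \<noteq> 0\<close> \<open>degree \<pi> > 0\<close> by (simp add: degree_mult_eq)
  moreover have "c dvd Q" using D c by (metis dvd_mult_right)
  \<comment> \<open>The surviving index \<open>i1\<close> may differ from \<open>i0\<close>; its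
    restricted character becomes the reference \<Phi> through which all the others are
    expressed.\<close>
  ultimately obtain i1 z1 where i1: "i1 \<in> I" "\<psi> i1 (c * z1) \<noteq> 1" using min[of c] by force
  define \<phi> where "\<phi> i w = \<psi> i (c * w)" for i w
  have \<phi>: "character_mod \<pi> (\<phi> i)" if "i \<in> I" for i
  proof -
    have "\<psi> i (c * (\<pi> * z)) = 1" for z
      using D that by (metis c mult.assoc mult.commute)
    then show ?thesis using character_mod_add[OF \<psi>[OF that]]
      by (simp add: character_mod_def \<phi>_def distrib_left)
  qed
  define \<Phi> where "\<Phi> = \<phi> i1"
  have \<Phi>: "character_mod \<pi> \<Phi>" "\<Phi> z1 \<noteq> 1" using \<phi>[OF i1(1)] i1 by (simp_all add: \<Phi>_def \<phi>_def)
  have \<Phi>_dvd: "\<Phi> (W * z1) = 1" if "\<pi> dvd W" for W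
    using that character_mod_mult[OF \<Phi>(1)] by (auto simp: mult.assoc elim!: dvdE)
  have "\<exists>b. \<forall>w. \<phi> i w = \<Phi> (b * w)" if "i \<in> I" for i
    by (rule character_mod_prime_self_dual[OF pe \<Phi> \<phi>[OF that]])
  then obtain b where b: "\<And>i w. i \<in> I \<Longrightarrow> \<phi> i w = \<Phi> (b i * w)" by metis
  have "\<not> \<pi> dvd b i1" using b[OF i1(1), of z1] \<Phi>_dvd \<Phi>(2) by (auto simp: \<Phi>_def[symmetric])
  have "\<exists>\<beta>. \<forall>x. \<Phi> (x ^ (p ^ l)) = \<Phi> (\<beta> * x)" for l
  proof (rule character_mod_prime_self_dual[OF pe \<Phi>])
    have "\<pi> dvd (\<pi> * z) ^ (p ^ l)" for z
      using p0 by (simp add: power_mult_distrib dvd_power)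
    then have "\<Phi> ((\<pi> * z) ^ (p ^ l)) = 1" for z
      using character_mod_cong[OF \<Phi>(1), of _ 0] character_mod_0[OF \<Phi>(1)] by simp
    moreover have "(x + y) ^ (p ^ l) = x ^ (p ^ l) + y ^ (p ^ l)" for x y :: "'a poly"
      unfolding pCHAR by (rule power_CHAR_power_add[OF charp])
    ultimately show "character_mod \<pi> (\<lambda>x. \<Phi> (x ^ (p ^ l)))"
      unfolding character_mod_def by (simp add: character_mod_add[OF \<Phi>(1)])
  qed
  then obtain \<beta> where \<beta>: "\<And>l x. \<Phi> (x ^ (p ^ l)) = \<Phi> (\<beta> l * x)" by metis
  have "\<not> \<pi> dvd \<beta> 0" using \<beta>[of z1 0] \<Phi>_dvd[of "\<beta> 0"] \<Phi>(2) by auto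
  define J where "J = (SIGMA i:I. permutations_of_multiset (e i))"
  define l where "l = (\<lambda>(i :: 'i, \<tau> :: nat list). hd \<tau>)"
  \<comment> \<open>Pulling one factor c out of (c z)^(p^k) leaves c^(p^k - 1). Here \<pi> may still
    divide c, and then the coefficient survives only for k = 0, where this exponent is 0.\<close>
  define K where "K = (\<lambda>(i, \<tau>). b i * of_nat (multiplicity_factor (e i)) * c ^ (p ^ hd \<tau> - 1))"
  define X where "X us = (\<lambda>(i :: 'i, \<tau>). multimonomial us (map ((^) p) (tl \<tau>)) :: 'a poly)" for us
  \<comment> \<open>The coefficient after raising to the power p^L: a p^l-th root of
    \<open>K t * X us t\<close> turns into the power p^(L - l) of that product.\<close>
  define C where "C t = \<beta> (l t) ^ (p ^ L) * K t ^ (p ^ (L - l t))" for t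
  define E where "E = (\<lambda>(i :: 'i, \<tau>). map ((*) (p ^ (L - hd \<tau>))) (map ((^) p) (tl \<tau>)))"
  have finJ: "finite J" using I by (simp add: J_def)
  have JD: "\<exists>k \<sigma>. \<tau> = k # \<sigma> \<and> e i = add_mset k (mset \<sigma>) \<and> length \<sigma> = m \<and> k \<le> L \<and> set \<sigma> \<subseteq> {..L}"
    if "i \<in> I" "\<tau> \<in> permutations_of_multiset (e i)" for i \<tau>
  proof -
    have mset: "mset \<tau> = e i" using that by (simp add: permutations_of_multiset_def)
    then have "length \<tau> = Suc m" using size_e[OF that(1)] by (metis size_mset)
    then obtain k \<sigma> where \<tau>: "\<tau> = k # \<sigma>" "length \<sigma> = m" by (auto simp: length_Suc_conv)
    then have e: "e i = add_mset k (mset \<sigma>)" using mset by simp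
    then have "k \<le> L" "set \<sigma> \<subseteq> {..L}" using e_le[OF that(1)] by auto
    then show ?thesis using \<tau> e by auto
  qed
  have trivial_imp: "\<pi> dvd (\<Sum>t\<in>J. C t * multimonomial us (E t))"
    if triv: "\<And>y. (\<Prod>i\<in>I. \<psi> i (polarization p (e i) (y # us))) = 1" for us
  proof -
    \<comment> \<open>With \<open>a t\<close> a p^l-th root of \<open>K t * X us t\<close> modulo
      \<pi>, the summand K X z^(p^l) becomes (a z)^(p^l), and the adjoint of Frobenius turns it into
      \<beta>_l a z, linear in z. The condition is then \<Phi> (W z) = 1 for all z.\<close>
    have "\<exists>a. \<pi> dvd a ^ (p ^ l t) - K t * X us t" for t
      unfolding p_def by (rule power_CHAR_power_root_mod[OF pe])
    then obtain a where a: "\<And>t. \<pi> dvd a t ^ (p ^ l t) - K t * X us t" by metis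
    define W where "W = (\<Sum>t\<in>J. \<beta> (l t) * a t)"
    have W: "\<Phi> (W * z) = 1" for z
    proof -
      have "\<psi> i (polarization p (e i) (c * z # us))
          = (\<Prod>\<tau>\<in>permutations_of_multiset (e i). \<Phi> (\<beta> (l (i, \<tau>)) * a (i, \<tau>) * z))" if i: "i \<in> I" for i
      proof -
        have "polarization p (e i) (c * z # us) = c * (\<Sum>\<tau>\<in>permutations_of_multiset (e i).
            of_nat (multiplicity_factor (e i)) * c ^ (p ^ hd \<tau> - 1) * X us (i, \<tau>) * z ^ (p ^ hd \<tau>))"
          unfolding polarization_def sum_distrib_left
        proof (rule sum.cong[OF refl])
          fix \<tau> assume "\<tau> \<in> permutations_of_multiset (e i)"
          then obtain k \<sigma> where \<tau>: "\<tau> = k # \<sigma>" using JD[OF i] by blast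
          have "c ^ (p ^ k) = c * c ^ (p ^ k - 1)" using p0 by (metis power_minus_mult mult.commute zero_less_power)
          then show "of_nat (multiplicity_factor (e i)) * multimonomial (c * z # us) (map ((^) p) \<tau>) =
            c * (of_nat (multiplicity_factor (e i)) * c ^ (p ^ hd \<tau> - 1) * X us (i, \<tau>) * z ^ (p ^ hd \<tau>))"
            by (simp add: \<tau> X_def power_mult_distrib mult_ac)
        qed
        then have "\<psi> i (polarization p (e i) (c * z # us)) = \<phi> i (\<Sum>\<tau>\<in>permutations_of_multiset (e i).
            of_nat (multiplicity_factor (e i)) * c ^ (p ^ hd \<tau> - 1) * X us (i, \<tau>) * z ^ (p ^ hd \<tau>))"
          by (simp add: \<phi>_def)
        also have "\<dots> = \<Phi> (\<Sum>\<tau>\<in>permutations_of_multiset (e i). K (i, \<tau>) * X us (i, \<tau>) * z ^ (p ^ hd \<tau>))"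
          unfolding b[OF i] by (simp add: K_def sum_distrib_left mult.assoc)
        also have "\<dots> = (\<Prod>\<tau>\<in>permutations_of_multiset (e i). \<Phi> (K (i, \<tau>) * X us (i, \<tau>) * z ^ (p ^ hd \<tau>)))"
          by (rule character_mod_sum[OF \<Phi>(1)])
        also have "\<dots> = (\<Prod>\<tau>\<in>permutations_of_multiset (e i). \<Phi> (\<beta> (l (i, \<tau>)) * a (i, \<tau>) * z))"
        proof (rule prod.cong[OF refl])
          fix \<tau> :: "nat list"
          let ?t = "(i, \<tau>)"
          have "\<Phi> (K ?t * X us ?t * z ^ (p ^ hd \<tau>)) = \<Phi> ((a ?t * z) ^ (p ^ hd \<tau>))"
          proof (rule character_mod_cong[OF \<Phi>(1)])
            have "\<pi> dvd (a ?t ^ (p ^ hd \<tau>) - K ?t * X us ?t) * z ^ (p ^ hd \<tau>)"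
              using a[of ?t] by (simp add: l_def)
            then show "\<pi> dvd K ?t * X us ?t * z ^ (p ^ hd \<tau>) - (a ?t * z) ^ (p ^ hd \<tau>)"
              by (subst dvd_diff_commute) (simp add: left_diff_distrib power_mult_distrib)
          qed
          then show "\<Phi> (K ?t * X us ?t * z ^ (p ^ hd \<tau>)) = \<Phi> (\<beta> (l ?t) * a ?t * z)"
            by (simp add: \<beta> l_def mult.assoc)
        qed
        finally show ?thesis .
      qed
      then have "1 = (\<Prod>i\<in>I. \<Prod>\<tau>\<in>permutations_of_multiset (e i). \<Phi> (\<beta> (l (i, \<tau>)) * a (i, \<tau>) * z))"
        using triv[of "c * z"] by simp
      also have "\<dots> = (\<Prod>t\<in>J. \<Phi> (\<beta> (l t) * a t * z))"
        unfolding J_def by (subst prod.Sigma) (simp_all add: I case_prod_beta)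
      also have "\<dots> = \<Phi> (W * z)"
        by (simp add: W_def sum_distrib_right character_mod_sum[OF \<Phi>(1)])
      finally show ?thesis by simp
    qed
    have "\<pi> dvd W"
    proof (rule ccontr)
      assume "\<not> \<pi> dvd W"
      then obtain w where "\<pi> dvd w * W - z1" using mult_inverse_mod[OF pe] by blast
      then have "\<Phi> (W * w) = \<Phi> z1" using character_mod_cong[OF \<Phi>(1)] by (metis mult.commute)
      then show False using W \<Phi>(2) by simp
    qed
    \<comment> \<open>The root \<open>a t\<close> is not polynomial in \<open>us\<close>, but modulo
      \<pi> its p^L-th power is; this power is additive and so passes through the sum
      \<open>W\<close>.\<close>
    then have "\<pi> dvd W ^ (p ^ L)" using p0 by (meson dvd_power dvd_trans dvd_power_same zero_less_power)
    also have "W ^ (p ^ L) = (\<Sum>t\<in>J. (\<beta> (l t) * a t) ^ (p ^ L))"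
      unfolding W_def by (rule freshmans_dream_sum'[OF charp]) (simp add: pCHAR)
    finally have 1: "\<pi> dvd (\<Sum>t\<in>J. (\<beta> (l t) * a t) ^ (p ^ L))" .
    have "\<pi> dvd (\<Sum>t\<in>J. (\<beta> (l t) * a t) ^ (p ^ L) - C t * multimonomial us (E t))"
    proof (rule dvd_sum)
      fix t assume "t \<in> J"
      then obtain i k \<sigma> where t: "t = (i, k # \<sigma>)" and "k \<le> L" using JD by (force simp: J_def)
      have "p ^ L = p ^ k * p ^ (L - k)" using \<open>k \<le> L\<close> by (simp flip: power_add)
      then have aL: "a t ^ (p ^ L) = (a t ^ (p ^ k)) ^ (p ^ (L - k))" by (simp add: power_mult)
      have "C t * multimonomial us (E t) = \<beta> k ^ (p ^ L) * (K t * X us t) ^ (p ^ (L - k))"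
        by (simp add: C_def E_def t l_def X_def multimonomial_power power_mult_distrib)
      then have "(\<beta> (l t) * a t) ^ (p ^ L) - C t * multimonomial us (E t)
          = \<beta> k ^ (p ^ L) * ((a t ^ (p ^ k)) ^ (p ^ (L - k)) - (K t * X us t) ^ (p ^ (L - k)))"
        by (simp add: power_mult_distrib aL right_diff_distrib) (simp add: t l_def)
      moreover have "\<pi> dvd (a t ^ (p ^ k)) ^ (p ^ (L - k)) - (K t * X us t) ^ (p ^ (L - k))"
        using a[of t] by (intro dvd_diff_power) (simp add: t l_def)
      ultimately show "\<pi> dvd (\<beta> (l t) * a t) ^ (p ^ L) - C t * multimonomial us (E t)" by simp
    qed
    then have 2: "\<pi> dvd (\<Sum>t\<in>J. (\<beta> (l t) * a t) ^ (p ^ L)) - (\<Sum>t\<in>J. C t * multimonomial us (E t))"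
      by (simp add: sum_subtractf)
    show ?thesis using dvd_diff[OF 1 2] by simp
  qed
  have inj: "inj_on E J"
  proof (rule inj_onI)
    fix t t' assume t: "t \<in> J" "t' \<in> J" and eq: "E t = E t'"
    obtain i k \<sigma> where i: "t = (i, k # \<sigma>)" "i \<in> I" "e i = add_mset k (mset \<sigma>)" "k \<le> L"
      using JD t(1) by (force simp: J_def)
    obtain i' k' \<sigma>' where i': "t' = (i', k' # \<sigma>')" "i' \<in> I" "e i' = add_mset k' (mset \<sigma>')" "k' \<le> L"
      using JD t(2) by (force simp: J_def)
    \<comment> \<open>The missing head contributes p^(L-k) * p^k = p^L whatever k is. So the total
      degree determines p^(L-k) times the exponent of i, and as p does not divide that exponent,
      both k and i.\<close>
    have sum: "sum_list (E (i, k # \<sigma>)) + p ^ L = p ^ (L - k) * power_sum_of p (e i)"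
      if "e i = add_mset k (mset \<sigma>)" "k \<le> L" for i k \<sigma>
    proof -
      have "p ^ L = p ^ (L - k) * p ^ k" using \<open>k \<le> L\<close> by (simp flip: power_add)
      moreover have "sum_list (E (i, k # \<sigma>)) = p ^ (L - k) * power_sum_of p (mset \<sigma>)"
        by (simp add: E_def sum_list_const_mult flip: sum_list_map_power) (simp add: o_def sum_list_const_mult)
      ultimately show ?thesis using that by (simp add: algebra_simps)
    qed
    have "p ^ (L - k) * power_sum_of p (e i) = p ^ (L - k') * power_sum_of p (e i')"
      using sum[OF i(3,4)] sum[OF i'(3,4)] eq i(1) i'(1) by simp
    then have "L - k = L - k'" "power_sum_of p (e i) = power_sum_of p (e i')"
      using power_mult_not_dvd_unique[OF _ e_dvd[OF i(2)] e_dvd[OF i'(2)] p0] by blast+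
    then have "i = i'" "k = k'" using e_inj i i' by (auto simp: inj_on_def)
    moreover have "\<sigma> = \<sigma>'"
    proof -
      have "inj ((*) (p ^ (L - k)))" "inj ((^) p)" using p1 by (auto simp: inj_def)
      then show ?thesis using eq i(1) i'(1) \<open>k = k'\<close> by (simp add: E_def inj_map_eq_map del: map_map)
    qed
    ultimately show "t = t'" using i(1) i'(1) by simp
  qed
  \<comment> \<open>For an arrangement that starts with the digit position 0, the coefficient is
    made of \<open>\<beta> 0\<close>, \<open>b i1\<close> and the multiplicity factor, none of which
    is divisible by \<pi>.\<close>
  have "0 \<in># e i1" using e_dvd[OF i1(1)] dvd_power_sum_of by blast
  then obtain e' where "e i1 = add_mset 0 e'" by (metis insert_DiffM)
  then obtain \<sigma> where \<sigma>: "0 # \<sigma> \<in> permutations_of_multiset (e i1)"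
    by (metis ex_mset mset.simps(2) permutations_of_multisetI)
  let ?t = "(i1, 0 # \<sigma>)"
  have "\<not> \<pi> dvd of_nat (multiplicity_factor (e i1))"
    using multiplicity_factor_not_dvd[OF char count_e[OF i1(1)]]
    by (intro prime_elem_not_dvd_of_nat[OF pe]) (simp add: p_def)
  then have "\<not> \<pi> dvd b i1 * of_nat (multiplicity_factor (e i1))"
    using \<open>\<not> \<pi> dvd b i1\<close> pe by (simp add: prime_elem_dvd_mult_iff)
  moreover have "\<not> \<pi> dvd x ^ N" if "\<not> \<pi> dvd x" for x N
    using that prime_elem_dvd_power[OF pe] by blast
  ultimately have "\<not> \<pi> dvd C ?t"
    using \<open>\<not> \<pi> dvd \<beta> 0\<close> pe by (simp add: C_def K_def l_def prime_elem_dvd_mult_iff)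
  let ?N = "poly_abs Q div poly_abs \<pi>"
  let ?B = "{us. set us \<subseteq> ?R \<and> length us = m \<and> (\<forall>y. (\<Prod>i\<in>I. \<psi> i (polarization p (e i) (y # us))) = 1)}"
  let ?G = "{us. set us \<subseteq> ?R \<and> length us = m \<and> \<pi> dvd (\<Sum>t\<in>J. C t * multimonomial us (E t))}"
  have "card ?G \<le> m * p ^ (2 * L) * ?N * card ?R ^ (m - 1)"
  proof (rule card_indexed_multimonomial_roots_mod[OF _ finite_residues_mod[OF Q]
        card_residues_mod_fibre_le[OF Q \<pi>Q] finJ inj])
    show "\<pi> dvd x * y \<Longrightarrow> \<pi> dvd x \<or> \<pi> dvd y" for x y using pe by (simp add: prime_elem_dvd_mult_iff)
    show "?t \<in> J" using i1 \<sigma> by (simp add: J_def)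
    fix t assume "t \<in> J"
    then obtain i k \<sigma> where t: "t = (i, k # \<sigma>)" "length \<sigma> = m" "set \<sigma> \<subseteq> {..L}"
      using JD by (force simp: J_def)
    \<comment> \<open>The factor p^(L-k) stems from clearing the roots, p^s from the monomial
      itself.\<close>
    have "p ^ (L - k) * p ^ s \<le> p ^ (2 * L)" if "s \<in> set \<sigma>" for s
    proof -
      have "L - k + s \<le> 2 * L" using t(3) that by fastforce
      then show ?thesis using p0 by (simp add: power_increasing flip: power_add)
    qed
    then show "length (E t) = m \<and> set (E t) \<subseteq> {..p ^ (2 * L)}" using t by (auto simp: E_def)
  qed fact
  moreover have "card ?B \<le> card ?G"
    using trivial_imp finite_lists_length_eq[OF finite_residues_mod[OF Q], of m]
    by (intro card_mono) (auto intro: rev_finite_subset)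
  ultimately have "card ?B \<le> m * p ^ (2 * L) * ?N * card ?R ^ (m - 1)" by simp
  then have "card ?B * poly_abs \<pi> \<le> m * p ^ (2 * L) * ?N * card ?R ^ (m - 1) * poly_abs \<pi>" by simp
  also have "\<dots> = m * p ^ (2 * L) * (?N * poly_abs \<pi>) * card ?R ^ (m - 1)" by simp
  also have "\<dots> \<le> m * p ^ (2 * L) * card ?R * card ?R ^ (m - 1)"
    by (intro mult_right_mono mult_left_mono) (simp_all add: card_residues_mod[OF Q])
  \<comment> \<open>For m = 0 both sides vanish, so the truncated \<open>m - 1\<close> is
    harmless.\<close>
  also have "\<dots> = m * p ^ (2 * L) * card ?R ^ m" by (cases m) simp_all
  finally show ?thesis using \<pi>(1,2) \<pi>Q by blast
qed

section \<open>The exponential sum\<close>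

lemma diff_dvd_poly_diff:
  fixes q :: "'b::comm_ring_1 poly"
  shows "x - y dvd poly q x - poly q y"
proof (induction q)
  case (pCons a q)
  have "poly (pCons a q) x - poly (pCons a q) y = (x - y) * poly q x + y * (poly q x - poly q y)"
    by (simp add: algebra_simps)
  then show ?case using pCons.IH by simp
qed simp

text \<open>An irreducible factor rules out the default value \<open>lpf Q = 0\<close>. The minimum
  is over a finite set because divisors of Q have absolute value at most |Q|.\<close>

lemma lpf_le_poly_abs:
  assumes Q: "Q \<noteq> 0" and \<pi>: "irreducible \<pi>" "lead_coeff \<pi> = 1" "\<pi> dvd Q"
  shows "0 < lpf Q \<and> lpf Q \<le> poly_abs \<pi>"
proof -
  let ?S = "{\<pi>. irreducible \<pi> \<and> lead_coeff \<pi> = 1 \<and> \<pi> dvd Q}"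
  have "poly_abs ` ?S \<subseteq> {..poly_abs Q}"
    using dvd_imp_degree_le[OF _ Q] by (auto simp: poly_abs_def intro!: power_increasing)
  then have fin: "finite (poly_abs ` ?S)" by (rule finite_subset) simp
  have mem: "poly_abs \<pi> \<in> poly_abs ` ?S" using \<pi> by blast
  have "\<pi> \<noteq> 0" "\<not> \<pi> dvd 1" using \<pi>(1) by (auto simp: irreducible_def)
  then have "degree \<pi> > 0" by (auto simp: is_unit_iff_degree)
  then have "degree Q \<noteq> 0" using dvd_imp_degree_le[OF \<pi>(3) Q] by simp
  then have lpf: "lpf Q = Min (poly_abs ` ?S)" by (simp add: lpf_def)
  moreover have "Min (poly_abs ` ?S) \<in> poly_abs ` ?S" using fin mem by (intro Min_in) auto
  ultimately show ?thesis using Min_le[OF fin mem] poly_abs_pos by auto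
qed

lemma polarization_Cons_add:
  fixes x y :: "'b::comm_ring_1"
  assumes "prime CHAR('b)" "e \<noteq> {#}"
  shows "polarization CHAR('b) e ((x + y) # us)
    = polarization CHAR('b) e (x # us) + polarization CHAR('b) e (y # us)"
  using assms by (simp add: polarization_Cons power_CHAR_power_add distrib_left distrib_right sum.distrib)

lemma dvd_polarization_Cons:
  fixes x :: "'b::comm_ring_1"
  assumes "p > 0" "e \<noteq> {#}"
  shows "x dvd polarization p e (x # us)"
  unfolding polarization_Cons[OF assms(2)]
  using assms(1) by (intro dvd_sum dvd_mult2 dvd_mult dvd_power) simp

text \<open>Let m + 1 be the largest digit sum among the summands on which \<chi> \<circ> \<eta>_i
  is nontrivial. Then m differences turn \<chi> (P y) into a constant times a character in y, whose
  average has modulus 0 or 1, so van der Corput counts the directions for which this character is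
  trivial.\<close>

lemma character_sum_bound:
  fixes P :: "'a::{field,finite} poly poly" and \<eta> :: "nat \<Rightarrow> 'a poly poly" and r :: "nat \<Rightarrow> nat"
    and \<chi> :: "'a poly \<Rightarrow> complex"
  defines "p \<equiv> CHAR('a)" and "d \<equiv> degree P" and "k \<equiv> derivational_degree P"
  assumes P: "P = [:a0:] + (\<Sum>i=1..n. pcompose (\<eta> i) (monom 1 (r i)))"
    and \<eta>: "\<And>i. i \<in> {1..n} \<Longrightarrow> \<eta> i \<noteq> 0 \<and> additive_poly (\<eta> i)"
    and r: "\<And>i. i \<in> {1..n} \<Longrightarrow> r i > 0 \<and> \<not> p dvd r i" "inj_on r {1..n}"
    and Q: "Q \<noteq> 0" and \<chi>: "character_mod Q \<chi>"
    and nontriv: "i0 \<in> {1..n}" "\<chi> (poly (\<eta> i0) y0) \<noteq> 1"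
  shows "cmod (average (residues_mod Q) (\<lambda>y. \<chi> (poly P y))) ^ (2 ^ (k - 1))
    \<le> real p powi (2 * \<lfloor>log (real p) (real d)\<rfloor>) * ((real k - 1) / real (lpf Q))"
proof -
  let ?R = "residues_mod Q"
  have char: "prime p" and charp: "prime CHAR('a poly)" and pCHAR: "p = CHAR('a poly)"
    by (simp_all add: p_def prime_CHAR_finite)
  have p0: "p > 0" and p1: "p > 1" using prime_gt_1_nat[OF char] by simp_all
  have inf: "infinite (UNIV :: 'a poly set)"
  proof -
    have "inj (\<lambda>n. monom (1 :: 'a) n)" by (auto simp: inj_def monom_eq_iff')
    then show ?thesis by (metis range_inj_infinite infinite_super subset_UNIV)
  qed
  define e where "e i = digit_multiset p (r i)" for i
  have pse: "power_sum_of p (e i) = r i" for i by (simp add: e_def power_sum_of_digit_multiset[OF p1])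
  have \<eta>_add: "poly (\<eta> i) (x + y) = poly (\<eta> i) x + poly (\<eta> i) y" if "i \<in> {1..n}" for i x y
    using \<eta>[OF that] poly_add_of_additive_poly by blast
  have \<eta>_0: "poly (\<eta> i) 0 = 0" if "i \<in> {1..n}" for i
    using \<eta>_add[OF that, of 0 0] by (metis add.right_neutral add_left_cancel)
  \<comment> \<open>Different i contribute disjoint sets of exponents p^j * r_i, because p divides
    no r_i and the r_i are distinct. So nothing cancels in P, and its degree and derivational degree
    control every r_i.\<close>
  have exponent: "\<exists>j. coeff P (p ^ j * r i) \<noteq> 0" if i: "i \<in> {1..n}" for i
  proof -
    have exp: "\<exists>j. m = p ^ j" if "i \<in> {1..n}" "coeff (\<eta> i) m \<noteq> 0" for i m
      unfolding pCHAR using \<eta>[OF that(1)] that(2) by (intro additive_poly_exponent[OF charp inf]) auto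
    have "lead_coeff (\<eta> i) \<noteq> 0" using \<eta>[OF i] by simp
    then obtain j where j: "coeff (\<eta> i) (p ^ j) \<noteq> 0" using exp[OF i] by metis
    have "coeff (pcompose (\<eta> i') (monom 1 (r i'))) (p ^ j * r i) = (if i' = i then coeff (\<eta> i) (p ^ j) else 0)"
      if i': "i' \<in> {1..n}" for i'
    proof (cases "i' = i")
      case False
      have "coeff (pcompose (\<eta> i') (monom 1 (r i'))) (p ^ j * r i) = 0"
      proof (rule ccontr)
        assume "\<not> ?thesis"
        then obtain m where m: "p ^ j * r i = r i' * m" "coeff (\<eta> i') m \<noteq> 0"
          using r(1)[OF i'] by (auto simp: coeff_pcompose_monom split: if_splits elim!: dvdE)
        then obtain j' where "p ^ j * r i = p ^ j' * r i'" using exp[OF i'] by (metis mult.commute)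
        then have "r i = r i'" using power_mult_not_dvd_unique p0 r(1)[OF i] r(1)[OF i'] by blast
        then show False using r(2) i i' False by (auto dest: inj_onD)
      qed
      then show ?thesis using False by simp
    qed (use r(1)[OF i] in \<open>simp add: coeff_pcompose_monom\<close>)
    then have "(\<Sum>i'=1..n. coeff (pcompose (\<eta> i') (monom 1 (r i'))) (p ^ j * r i)) = coeff (\<eta> i) (p ^ j)"
      using i by simp
    moreover have "coeff [:a0:] (p ^ j * r i) = 0"
      using r(1)[OF i] p0 by (simp add: coeff_pCons split: nat.splits)
    ultimately have "coeff P (p ^ j * r i) = coeff (\<eta> i) (p ^ j)" by (simp add: P coeff_sum)
    then show ?thesis using j by metis
  qed
  have size_le: "size (e i) \<le> k" if i: "i \<in> {1..n}" for i
  proof -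
    obtain j where "coeff P (p ^ j * r i) \<noteq> 0" using exponent[OF i] by blast
    then have "size (digit_multiset p (p ^ j * r i)) \<le> k"
      unfolding pCHAR k_def
      by (intro size_digit_multiset_le[OF charp inf vanishing_differences_derivational_degree])
    then show ?thesis by (simp add: e_def size_digit_multiset_power_mult[OF p1])
  qed
  have size_pos: "size (e i) > 0" if "i \<in> {1..n}" for i
    using r(1)[OF that] pse[of i] by (cases "e i") auto
  define L where "L = nat \<lfloor>log (real p) (real d)\<rfloor>"
  have r_le: "r i \<le> d" if i: "i \<in> {1..n}" for i
  proof -
    obtain j where "coeff P (p ^ j * r i) \<noteq> 0" using exponent[OF i] by blast
    then have "p ^ j * r i \<le> d" unfolding d_def by (rule le_degree)
    moreover have "1 * r i \<le> p ^ j * r i" using p0 by (intro mult_right_mono) simp_all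
    ultimately show ?thesis by linarith
  qed
  have d_pos: "d > 0" using r_le[OF nontriv(1)] r(1)[OF nontriv(1)] by simp
  have floor: "\<lfloor>log (real p) (real d)\<rfloor> = int L"
    using p1 d_pos by (simp add: L_def)
  have e_le: "l \<le> L" if "i \<in> {1..n}" "l \<in># e i" for i l
  proof -
    have "p ^ l \<le> d" using le_power_sum_of[OF that(2), of p] r_le[OF that(1)] pse[of i] by simp
    then have "real l \<le> log (real p) (real d)"
      using p1 by (intro le_log_of_power) (simp_all flip: of_nat_power)
    then show ?thesis unfolding L_def by (simp add: le_nat_floor)
  qed
  define \<psi> where "\<psi> i z = \<chi> (poly (\<eta> i) z)" for i z
  have \<psi>: "character_mod Q (\<psi> i)" if "i \<in> {1..n}" for i
  proof -
    have "Q dvd poly (\<eta> i) (Q * z) - 0" for z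
      using diff_dvd_poly_diff[of "Q * z" 0 "\<eta> i"] \<eta>_0[OF that] by (simp add: dvd_mult_left)
    then have "\<chi> (poly (\<eta> i) (Q * z)) = 1" for z
      using character_mod_cong[OF \<chi>] character_mod_0[OF \<chi>] by metis
    then show ?thesis
      by (simp add: character_mod_def \<psi>_def \<eta>_add[OF that] character_mod_add[OF \<chi>])
  qed
  define I0 where "I0 = {i \<in> {1..n}. \<exists>y. \<psi> i y \<noteq> 1}"
  have I0: "finite I0" "i0 \<in> I0" using nontriv by (auto simp: I0_def \<psi>_def)
  define s where "s = Max ((\<lambda>i. size (e i)) ` I0)"
  have s_ge: "size (e i) \<le> s" if "i \<in> I0" for i using that I0 by (simp add: s_def)
  have "s \<in> (\<lambda>i. size (e i)) ` I0" unfolding s_def using I0 by (intro Max_in) auto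
  then obtain i1 where i1: "i1 \<in> I0" "size (e i1) = s" by auto
  have i1n: "i1 \<in> {1..n}" using i1 by (simp add: I0_def)
  obtain m where m: "s = Suc m" using size_pos[OF i1n] i1 by (cases s) auto
  have "Suc m \<le> k" using size_le[OF i1n] i1 m by simp
  define I where "I = {i \<in> I0. size (e i) = s}"
  have I: "finite I" "I \<subseteq> {1..n}" "i1 \<in> I" using I0 i1 by (auto simp: I_def I0_def)
  obtain y1 where y1: "\<psi> i1 y1 \<noteq> 1" using i1 by (auto simp: I0_def)
  let ?F = "\<lambda>us y. \<Prod>i\<in>I. \<psi> i (polarization p (e i) (y # us))"
  have poly_P: "poly P = (\<lambda>y. a0 + (\<Sum>i=1..n. poly (\<eta> i) (y ^ r i)))"
    by (auto simp: P poly_sum poly_pcompose poly_monom)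
  \<comment> \<open>The value at y is the value at 0 times \<chi> of the difference with the further
    direction y, to which only the summands in \<open>I\<close> contribute.\<close>
  have diff_P: "\<chi> (fold difference us (poly P) y) = \<chi> (fold difference us (poly P) 0) * ?F us y"
    if us: "length us = m" for us y
  proof -
    have "fold difference (y # us) (poly P) 0 = fold difference (us @ [y]) (poly P) 0"
      by (simp only: fold_difference_rotate)
    also have "\<dots> = fold difference us (poly P) y - fold difference us (poly P) 0"
      by (simp add: difference_def)
    finally have "fold difference us (poly P) y
        = fold difference us (poly P) 0 + fold difference (y # us) (poly P) 0" by simp
    then have 1: "\<chi> (fold difference us (poly P) y)
        = \<chi> (fold difference us (poly P) 0) * \<chi> (fold difference (y # us) (poly P) 0)"
      by (simp add: character_mod_add[OF \<chi>])
    have "fold difference (y # us) (poly P) 0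
        = (\<Sum>i=1..n. poly (\<eta> i) (fold difference (y # us) (\<lambda>y. y ^ r i) 0))"
    proof -
      have "fold difference (y # us) (\<lambda>y. poly (\<eta> i) (y ^ r i)) 0
          = poly (\<eta> i) (fold difference (y # us) (\<lambda>y. y ^ r i) 0)" if "i \<in> {1..n}" for i
        using fold_difference_additive[where \<phi> = "poly (\<eta> i)" and g = "\<lambda>y. y ^ r i", OF \<eta>_add[OF that]]
        by (rule fun_cong)
      moreover have "fold difference (y # us) (\<lambda>y. a0) = (\<lambda>y. 0)"
        by (rule fold_difference_const) simp
      ultimately show ?thesis
        by (simp only: poly_P fold_difference_add fold_difference_sum add_0 cong: sum.cong)
    qed
    then have "\<chi> (fold difference (y # us) (poly P) 0)
        = (\<Prod>i=1..n. \<psi> i (fold difference (y # us) (\<lambda>y. y ^ r i) 0))"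
      by (simp add: character_mod_sum[OF \<chi>] \<psi>_def del: fold_simps)
    also have "\<dots> = ?F us y"
    proof (rule prod.mono_neutral_cong_right)
      show "\<forall>i\<in>{1..n} - I. \<psi> i (fold difference (y # us) (\<lambda>y. y ^ r i) 0) = 1"
      proof
        \<comment> \<open>Inside \<open>I0\<close> a smaller digit sum is killed by m + 1
          differences; outside \<open>I0\<close> the character \<open>\<psi> i\<close> is
          identically 1.\<close>
        fix i assume i: "i \<in> {1..n} - I"
        show "\<psi> i (fold difference (y # us) (\<lambda>y. y ^ r i) 0) = 1"
        proof (cases "i \<in> I0")
          case True
          then have "Suc (size (e i)) \<le> Suc m" using i s_ge[of i] m by (auto simp: I_def)
          then have "vanishing_differences (Suc m) (\<lambda>y :: 'a poly. y ^ power_sum_of p (e i))"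
            unfolding pCHAR by (rule vanishing_differences_mono[OF vanishing_differences_power_sum_of[OF charp]])
          then have "fold difference (y # us) (\<lambda>y. y ^ r i) 0 = 0"
            using us unfolding vanishing_differences_def pse by (metis length_Cons)
          then show ?thesis using i character_mod_0[OF \<psi>] by simp
        qed (use i in \<open>auto simp: I0_def\<close>)
      qed
      fix i assume "i \<in> I"
      then have "size (e i) = length (y # us)" using us m by (simp add: I_def)
      then have "fold difference (y # us) (\<lambda>y. y ^ power_sum_of p (e i)) 0 = polarization p (e i) (y # us)"
        unfolding pCHAR by (rule fold_difference_power_sum_of[OF charp])
      then show "\<psi> i (fold difference (y # us) (\<lambda>y. y ^ r i) 0) = \<psi> i (polarization p (e i) (y # us))"
        by (simp add: pse del: fold_simps)
    qed (use I in auto)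
    finally show ?thesis using 1 by simp
  qed
  have F_char: "character_mod Q (?F us)" for us
  proof -
    have ne: "e i \<noteq> {#}" if "i \<in> I" for i using that m by (auto simp: I_def)
    have \<psi>_I: "character_mod Q (\<psi> i)" if "i \<in> I" for i using that I(2) by (intro \<psi>) auto
    have "\<psi> i (polarization p (e i) ((Q * z) # us)) = 1" if i: "i \<in> I" for i z
    proof -
      have "Q dvd polarization p (e i) ((Q * z) # us)"
        using dvd_polarization_Cons[OF p0 ne[OF i], of "Q * z" us] by (rule dvd_mult_left)
      then have "\<psi> i (polarization p (e i) ((Q * z) # us)) = \<psi> i 0"
        by (intro character_mod_cong[OF \<psi>_I[OF i]]) simp
      then show ?thesis using character_mod_0[OF \<psi>_I[OF i]] by simp
    qed
    moreover have "\<psi> i (polarization p (e i) ((x + y) # us))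
        = \<psi> i (polarization p (e i) (x # us)) * \<psi> i (polarization p (e i) (y # us))" if i: "i \<in> I" for i x y
      unfolding pCHAR polarization_Cons_add[OF charp ne[OF i]] by (rule character_mod_add[OF \<psi>_I[OF i]])
    ultimately show ?thesis by (simp add: character_mod_def prod.distrib)
  qed
  define B where "B = {us. set us \<subseteq> ?R \<and> length us = m \<and> (\<forall>y. ?F us y = 1)}"
  have finL: "finite {us. set us \<subseteq> ?R \<and> length us = m}"
    by (rule finite_lists_length_eq[OF finite_residues_mod[OF Q]])
  have R: "real (card ?R) > 0" by (simp add: card_residues_mod[OF Q] poly_abs_pos)
  let ?E = "\<lambda>us. cmod (average ?R (\<lambda>y. \<chi> (fold difference us (poly P) y)))"
  have E_le: "?E us \<le> (if us \<in> B then 1 else 0)" if "us \<in> {us. set us \<subseteq> ?R \<and> length us = m}" for us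
  proof -
    have "?E us = cmod (\<Sum>y\<in>?R. ?F us y) / card ?R"
    proof -
      have "(\<Sum>y\<in>?R. \<chi> (fold difference us (poly P) y))
          = \<chi> (fold difference us (poly P) 0) * (\<Sum>y\<in>?R. ?F us y)"
        unfolding sum_distrib_left using that by (intro sum.cong refl diff_P) simp
      then show ?thesis by (simp add: average_def norm_divide norm_mult norm_character_mod[OF \<chi>])
    qed
    moreover have "(\<Sum>y\<in>?R. ?F us y) = 0" if no: "\<not> (\<forall>y. ?F us y = 1)"
      using sum_character_mod_eq_0[OF F_char] no by blast
    ultimately show ?thesis using that R by (auto simp: B_def)
  qed
  have "cmod (average ?R (\<lambda>y. \<chi> (poly P y))) ^ (2 ^ m)
      \<le> (\<Sum>us\<in>{us. set us \<subseteq> ?R \<and> length us = m}. ?E us) / real (card ?R) ^ m"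
    by (rule van_der_Corput[OF Q \<chi>]) (meson diff_dvd_poly_diff dvd_trans)
  also have "\<dots> \<le> (\<Sum>us\<in>{us. set us \<subseteq> ?R \<and> length us = m}. if us \<in> B then 1 else 0) / real (card ?R) ^ m"
    by (intro divide_right_mono sum_mono E_le) simp_all
  also have "(\<Sum>us\<in>{us. set us \<subseteq> ?R \<and> length us = m}. if us \<in> B then 1 else 0) = real (card B)"
  proof -
    have "{us. set us \<subseteq> ?R \<and> length us = m} \<inter> {us. us \<in> B} = B" by (auto simp: B_def)
    then show ?thesis using finL by (simp add: sum.If_cases)
  qed
  finally have le_B: "cmod (average ?R (\<lambda>y. \<chi> (poly P y))) ^ (2 ^ m) \<le> real (card B) / real (card ?R) ^ m" .
  have "\<exists>\<pi>. irreducible \<pi> \<and> lead_coeff \<pi> = 1 \<and> \<pi> dvd Q \<and>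
      card B * poly_abs \<pi> \<le> m * p ^ (2 * L) * card ?R ^ m"
    unfolding B_def p_def
  proof (rule card_polarization_trivial_le[where \<psi> = \<psi>, OF Q I(1) _ I(3) y1])
    fix i assume i: "i \<in> I"
    then have i': "i \<in> {1..n}" using I by auto
    show "character_mod Q (\<psi> i)" using \<psi>[OF i'] .
    show "size (e i) = Suc m" using i m by (simp add: I_def)
    show "count (e i) l < CHAR('a)" for l
      unfolding e_def p_def[symmetric] by (rule count_digit_multiset_less[OF p1])
    show "l \<le> L" if "l \<in># e i" for l using e_le[OF i' that] .
    show "\<not> CHAR('a) dvd power_sum_of CHAR('a) (e i)"
      using r(1)[OF i'] by (simp add: pse flip: p_def)
  next
    show "inj_on (\<lambda>i. power_sum_of CHAR('a) (e i)) I"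
      using inj_on_subset[OF r(2) I(2)] by (simp add: pse flip: p_def)
  qed
  then obtain \<pi> where \<pi>: "irreducible \<pi>" "lead_coeff \<pi> = 1" "\<pi> dvd Q"
    and B: "card B * poly_abs \<pi> \<le> m * p ^ (2 * L) * card ?R ^ m" by blast
  have lpf: "0 < real (lpf Q)" "real (lpf Q) \<le> real (poly_abs \<pi>)"
    using lpf_le_poly_abs[OF Q \<pi>] by simp_all
  have "real (card B) * real (poly_abs \<pi>) \<le> real m * real p ^ (2 * L) * real (card ?R) ^ m"
    using B by (simp flip: of_nat_mult of_nat_power add: of_nat_le_iff)
  then have "real (card B) / real (card ?R) ^ m \<le> real m * real p ^ (2 * L) / real (poly_abs \<pi>)"
    using R poly_abs_pos[of \<pi>] by (simp add: field_simps)
  also have "\<dots> \<le> (real k - 1) * real p ^ (2 * L) / real (lpf Q)"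
    using lpf \<open>Suc m \<le> k\<close> by (intro frac_le mult_right_mono mult_nonneg_nonneg) simp_all
  also have "\<dots> = real p powi (2 * \<lfloor>log (real p) (real d)\<rfloor>) * ((real k - 1) / real (lpf Q))"
    unfolding floor by (simp add: power_int_def nat_mult_distrib)
  finally have "cmod (average ?R (\<lambda>y. \<chi> (poly P y))) ^ (2 ^ m)
      \<le> real p powi (2 * \<lfloor>log (real p) (real d)\<rfloor>) * ((real k - 1) / real (lpf Q))"
    using le_B by simp
  \<comment> \<open>The exponent 2^m may be smaller than 2^(k - 1); as the average has modulus at
    most 1, a larger power only decreases it.\<close>
  moreover have "cmod (average ?R (\<lambda>y. \<chi> (poly P y))) \<le> 1"
    using sum_norm_le[of ?R "\<lambda>y. \<chi> (poly P y)" "\<lambda>_. 1"] R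
    by (simp add: average_def norm_divide norm_character_mod[OF \<chi>])
  then have "cmod (average ?R (\<lambda>y. \<chi> (poly P y))) ^ (2 ^ (k - 1))
      \<le> cmod (average ?R (\<lambda>y. \<chi> (poly P y))) ^ (2 ^ m)"
    using \<open>Suc m \<le> k\<close> by (intro power_decreasing[where n = "2 ^ m"]) (auto intro!: power_increasing)
  ultimately show ?thesis by simp
qed

section \<open>The multiplier bound\<close>

text \<open>Parseval turns both norms into sums over coefficients, compared term by term.\<close>

lemma L2_norm_character_sum_le:
  fixes X :: "('a::{field,finite} poly \<Rightarrow> complex) set"
  assumes Q: "Q \<noteq> 0" and X: "finite X" "\<And>\<chi>. \<chi> \<in> X \<Longrightarrow> character_mod Q \<chi>"
    and M: "M \<ge> 0" "\<And>\<chi>. \<chi> \<in> X \<Longrightarrow> cmod (w \<chi>) \<le> M"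
  shows "L2_norm (residues_mod Q) (\<lambda>x. \<Sum>\<chi>\<in>X. c \<chi> * w \<chi> * \<chi> x)
    \<le> M * L2_norm (residues_mod Q) (\<lambda>x. \<Sum>\<chi>\<in>X. c \<chi> * \<chi> x)"
proof -
  have "(\<Sum>\<chi>\<in>X. (cmod (c \<chi> * w \<chi>))\<^sup>2) \<le> (\<Sum>\<chi>\<in>X. M\<^sup>2 * (cmod (c \<chi>))\<^sup>2)"
    using M by (intro sum_mono) (simp add: norm_mult power_mult_distrib mult.commute[of "M\<^sup>2"] mult_left_mono power_mono)
  then have "sqrt (\<Sum>\<chi>\<in>X. (cmod (c \<chi> * w \<chi>))\<^sup>2) \<le> sqrt (M\<^sup>2 * (\<Sum>\<chi>\<in>X. (cmod (c \<chi>))\<^sup>2))"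
    by (simp add: sum_distrib_left)
  then show ?thesis
    using M(1) by (simp add: L2_norm_def parseval[OF Q X] real_sqrt_mult)
qed

lemma L2_norm_cong: "(\<And>x. x \<in> S \<Longrightarrow> f x = g x) \<Longrightarrow> L2_norm S f = L2_norm S g"
  by (simp add: L2_norm_def average_def)

text \<open>If \<chi> h \<noteq> 1 for some h in \<open>H\<close>, translation by h permutes the
  reduced image of \<open>H\<close> and multiplies the character sum by \<chi> h, so the sum is
  0.\<close>

lemma average_subgroup_character:
  fixes \<chi> :: "'a::{field,finite} poly \<Rightarrow> complex" and H :: "'a poly set"
  assumes Q: "Q \<noteq> 0" and \<chi>: "character_mod Q \<chi>"
    and H: "0 \<in> H" "\<And>x y. x \<in> H \<Longrightarrow> y \<in> H \<Longrightarrow> x - y \<in> H"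
  shows "average ((\<lambda>z. z mod Q) ` H) (\<lambda>z. \<chi> (a + z)) = (if \<forall>h\<in>H. \<chi> h = 1 then \<chi> a else 0)"
proof -
  let ?H = "(\<lambda>z. z mod Q) ` H"
  have "?H \<subseteq> residues_mod Q" by auto
  then have fin: "finite ?H" using finite_residues_mod[OF Q] finite_subset by blast
  have card: "card ?H > 0" using fin H(1) by (auto simp: card_gt_0_iff)
  have sum: "(\<Sum>z\<in>?H. \<chi> (a + z)) = \<chi> a * (\<Sum>z\<in>?H. \<chi> z)"
    by (simp add: character_mod_add[OF \<chi>] sum_distrib_left)
  show ?thesis
  proof (cases "\<forall>h\<in>H. \<chi> h = 1")
    case True
    then have "\<chi> z = 1" if "z \<in> ?H" for z using that character_mod_mod[OF \<chi>] by auto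
    then show ?thesis using True sum card by (simp add: average_def)
  next
    case False
    then obtain h where h: "h \<in> H" "\<chi> h \<noteq> 1" by auto
    have plus: "x + y \<in> H" if "x \<in> H" "y \<in> H" for x y
      using H(2)[OF that(1) H(2)[OF H(1) that(2)]] by simp
    have "(\<Sum>z\<in>?H. \<chi> z) = (\<Sum>z\<in>?H. \<chi> (z + h))"
    proof (rule sum.reindex_bij_witness[where i = "\<lambda>z. (z + h) mod Q" and j = "\<lambda>z. (z - h) mod Q"])
      fix z assume z: "z \<in> ?H"
      then have zQ: "z mod Q = z" by auto
      obtain y where y: "y \<in> H" "z = y mod Q" using z by blast
      show "((z - h) mod Q + h) mod Q = z" "((z + h) mod Q - h) mod Q = z"
        using zQ by (simp_all add: mod_diff_left_eq mod_add_left_eq)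
      have "(z - h) mod Q = (y - h) mod Q" "(z + h) mod Q = (y + h) mod Q"
        by (simp_all add: y mod_diff_left_eq mod_add_left_eq)
      then show "(z - h) mod Q \<in> ?H" "(z + h) mod Q \<in> ?H"
        using H(2)[OF y(1) h(1)] plus[OF y(1) h(1)] by auto
      show "\<chi> ((z - h) mod Q + h) = \<chi> z"
        using character_mod_add[OF \<chi>, of "(z - h) mod Q" h] character_mod_add[OF \<chi>, of "z - h" h]
        by (simp add: character_mod_mod[OF \<chi>])
    qed
    also have "\<dots> = (\<Sum>z\<in>?H. \<chi> z) * \<chi> h"
      by (simp add: character_mod_add[OF \<chi>] sum_distrib_right)
    finally have "(\<Sum>z\<in>?H. \<chi> z) = 0" using h by (metis mult_cancel_left1 mult.commute)
    then show ?thesis using False sum by (simp add: average_def del: ball_simps)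
  qed
qed

theorem theorem1p10:
  fixes P :: "'a::{field,finite} poly poly"
    and a0 :: "'a poly"
    and \<eta> :: "nat \<Rightarrow> 'a poly poly"
    and r :: "nat \<Rightarrow> nat"
    and n p d k :: nat
    and H :: "'a poly set"
    and Q :: "'a poly"
    and f :: "'a poly \<Rightarrow> complex"
  assumes "p = CHAR('a)"
    and "d = degree P" and "d > 0"
    and "k = derivational_degree P"
    and "P = [:a0:] + (\<Sum>i=1..n. pcompose (\<eta> i) (monom 1 (r i)))"
    and "\<And>i. i \<in> {1..n} \<Longrightarrow> \<eta> i \<noteq> 0 \<and> additive_poly (\<eta> i)"
    and "\<And>i. i \<in> {1..n} \<Longrightarrow> r i > 0 \<and> \<not> p dvd r i"
    and "inj_on r {1..n}"
    and "H = (\<Sum>i=1..n. range (poly (\<eta> i)))"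
    and "lead_coeff Q = 1"
  shows
    "L2_norm (residues_mod Q)
       (\<lambda>x. average (residues_mod Q) (\<lambda>y. f ((x + poly P y) mod Q))
          - average ((\<lambda>z. z mod Q) ` H) (\<lambda>z. f ((x + a0 + z) mod Q)))
     \<le> (real p powi (2 * \<lfloor>log (real p) (real d)\<rfloor>) * ((real k - 1) / real (lpf Q)))
          powr (1 / 2 ^ (k - 1))
       * L2_norm (residues_mod Q) f"
proof -
  let ?R = "residues_mod Q"
  let ?H = "(\<lambda>z. z mod Q) ` H"
  define X where "X = real p powi (2 * \<lfloor>log (real p) (real d)\<rfloor>) * ((real k - 1) / real (lpf Q))"
  define M where "M = X powr (1 / 2 ^ (k - 1))"
  have Q: "Q \<noteq> 0" using assms(10) by auto
  have H: "H = {\<Sum>i=1..n. s i | s. \<forall>i\<in>{1..n}. s i \<in> range (poly (\<eta> i))}"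
    unfolding assms(9) by (simp add: set_sum_alt)
  have \<eta>_add: "poly (\<eta> i) (x + y) = poly (\<eta> i) x + poly (\<eta> i) y" if "i \<in> {1..n}" for i x y
    using assms(6)[OF that] poly_add_of_additive_poly by blast
  have \<eta>_diff: "poly (\<eta> i) x - poly (\<eta> i) y = poly (\<eta> i) (x - y)" if "i \<in> {1..n}" for i x y
    using \<eta>_add[OF that, of "x - y" y] by simp
  have H_diff: "x - y \<in> H" if xy: "x \<in> H" "y \<in> H" for x y
  proof -
    obtain s t where s: "x = (\<Sum>i=1..n. s i)" "\<forall>i\<in>{1..n}. s i \<in> range (poly (\<eta> i))"
      and t: "y = (\<Sum>i=1..n. t i)" "\<forall>i\<in>{1..n}. t i \<in> range (poly (\<eta> i))"
      using xy unfolding H by blast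
    have "s i - t i \<in> range (poly (\<eta> i))" if i: "i \<in> {1..n}" for i
    proof -
      obtain u v where "s i = poly (\<eta> i) u" "t i = poly (\<eta> i) v" using s(2) t(2) i by blast
      then show ?thesis using \<eta>_diff[OF i] by simp
    qed
    moreover have "x - y = (\<Sum>i=1..n. s i - t i)" by (simp add: s t sum_subtractf)
    ultimately show ?thesis unfolding H by blast
  qed
  have poly_P: "poly P y = a0 + (\<Sum>i=1..n. poly (\<eta> i) (y ^ r i))" for y
    by (simp add: assms(5) poly_sum poly_pcompose poly_monom)
  have P_in: "(\<Sum>i=1..n. poly (\<eta> i) (y ^ r i)) \<in> H" for y
    unfolding H by blast
  have "0 \<in> H" using H_diff[OF P_in[of 0] P_in[of 0]] by simp
  have avg_H: "average ?H (\<lambda>z. \<chi> (a0 + z)) = (if \<forall>h\<in>H. \<chi> h = 1 then \<chi> a0 else 0)"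
    if "character_mod Q \<chi>" for \<chi>
    using \<open>0 \<in> H\<close> H_diff by (rule average_subgroup_character[OF Q that])
  have mult: "cmod (average ?R (\<lambda>y. \<chi> (poly P y)) - average ?H (\<lambda>z. \<chi> (a0 + z))) \<le> M"
    if \<chi>: "character_mod Q \<chi>" for \<chi>
  proof (cases "\<forall>h\<in>H. \<chi> h = 1")
    case True
    then have "\<chi> (poly P y) = \<chi> a0" for y
      using P_in by (simp add: poly_P character_mod_add[OF \<chi>])
    moreover have "card ?R > 0" by (simp add: card_residues_mod[OF Q] poly_abs_pos)
    ultimately have "average ?R (\<lambda>y. \<chi> (poly P y)) = \<chi> a0" by (simp add: average_def)
    then show ?thesis
      using avg_H[OF \<chi>] True by (simp add: M_def)
  next
    case False
    then obtain s where s: "\<forall>i\<in>{1..n}. s i \<in> range (poly (\<eta> i))" "\<chi> (\<Sum>i=1..n. s i) \<noteq> 1"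
      unfolding H by blast
    \<comment> \<open>A character that is nontrivial on a sum is nontrivial on one of its
      terms.\<close>
    then obtain i where i: "i \<in> {1..n}" "\<chi> (s i) \<noteq> 1"
      unfolding character_mod_sum[OF \<chi>] by (metis prod.neutral)
    obtain y where "s i = poly (\<eta> i) y" using s(1) i(1) by blast
    then have "\<chi> (poly (\<eta> i) y) \<noteq> 1" using i(2) by simp
    note bound = character_sum_bound[OF assms(5,6) assms(7)[unfolded assms(1)] assms(8) Q \<chi> i(1) this,
        folded assms(1,2,4)]
    define v where "v = cmod (average ?R (\<lambda>y. \<chi> (poly P y)))"
    have "v \<ge> 0" by (simp add: v_def)
    have bnd: "v ^ (2 ^ (k - 1)) \<le> X" using bound by (simp add: v_def X_def)
    have "v \<le> M"
    \<comment> \<open>The root is taken through \<open>powr\<close>, which needs v > 0. For k = 1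
      both \<open>X\<close> and \<open>M\<close> are 0, as 0 \<open>powr\<close> a = 0, and
      \<open>bnd\<close> leaves only v = 0. In any case \<open>M\<close> is nonnegative.\<close>
    proof (cases "v = 0")
      case False
      then have "v > 0" using \<open>v \<ge> 0\<close> by simp
      then have "v = (v ^ (2 ^ (k - 1))) powr (1 / 2 ^ (k - 1))"
        by (simp add: powr_powr flip: powr_realpow)
      also have "\<dots> \<le> M" unfolding M_def using bnd \<open>v > 0\<close> by (intro powr_mono2) simp_all
      finally show ?thesis .
    qed (simp add: M_def)
    moreover have "average ?H (\<lambda>z. \<chi> (a0 + z)) = 0"
      unfolding avg_H[OF \<chi>] using False by (rule if_not_P)
    ultimately show ?thesis by (simp add: v_def)
  qed
  \<comment> \<open>Only the values of f on residues matter; the periodic extension of these is the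
    function that expands into characters.\<close>
  have "(\<lambda>x. f (x mod Q)) \<in> character_span Q"
    by (rule periodic_in_character_span[OF Q]) simp
  then obtain S c where S: "finite S" "\<forall>\<chi>\<in>S. character_mod Q \<chi>"
    and f: "(\<lambda>x. f (x mod Q)) = (\<lambda>x. \<Sum>\<chi>\<in>S. c \<chi> * \<chi> x)"
    unfolding character_span_def by blast
  have S_add: "\<chi> (x + y) = \<chi> x * \<chi> y" if "\<chi> \<in> S" for \<chi> x y
    using S(2) that character_mod_add by blast
  have f': "f (x mod Q) = (\<Sum>\<chi>\<in>S. c \<chi> * \<chi> x)" for x using f by meson
  define w where "w \<chi> = average ?R (\<lambda>y. \<chi> (poly P y)) - average ?H (\<lambda>z. \<chi> (a0 + z))"
    for \<chi> :: "'a poly \<Rightarrow> complex"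
  have avg: "average A (\<lambda>y. f ((x + g y) mod Q)) = (\<Sum>\<chi>\<in>S. c \<chi> * \<chi> x * average A (\<lambda>y. \<chi> (g y)))"
    for A :: "'a poly set" and g x
  proof -
    have "(\<Sum>y\<in>A. f ((x + g y) mod Q)) = (\<Sum>y\<in>A. \<Sum>\<chi>\<in>S. c \<chi> * \<chi> x * \<chi> (g y))"
      by (intro sum.cong refl) (simp add: f' S_add mult.assoc)
    also have "\<dots> = (\<Sum>\<chi>\<in>S. c \<chi> * \<chi> x * (\<Sum>y\<in>A. \<chi> (g y)))"
      by (subst sum.swap) (simp add: sum_distrib_left)
    finally show ?thesis by (simp add: average_def sum_divide_distrib[where A = S])
  qed
  have "average ?R (\<lambda>y. f ((x + poly P y) mod Q)) - average ?H (\<lambda>z. f ((x + a0 + z) mod Q))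
      = (\<Sum>\<chi>\<in>S. c \<chi> * w \<chi> * \<chi> x)" for x
    unfolding add.assoc avg by (simp add: w_def sum_subtractf[symmetric] algebra_simps)
  then have "L2_norm ?R (\<lambda>x. average ?R (\<lambda>y. f ((x + poly P y) mod Q))
          - average ?H (\<lambda>z. f ((x + a0 + z) mod Q)))
      = L2_norm ?R (\<lambda>x. \<Sum>\<chi>\<in>S. c \<chi> * w \<chi> * \<chi> x)" by simp
  also have "\<dots> \<le> M * L2_norm ?R (\<lambda>x. \<Sum>\<chi>\<in>S. c \<chi> * \<chi> x)"
    using S mult by (intro L2_norm_character_sum_le Q) (simp_all add: w_def M_def)
  also have "L2_norm ?R (\<lambda>x. \<Sum>\<chi>\<in>S. c \<chi> * \<chi> x) = L2_norm ?R f"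
    by (rule L2_norm_cong) (metis f' mem_residues_mod)
  finally show ?thesis by (simp add: M_def X_def)
qed

end
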